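(* Let $d\ge2$ and $r>d$. If $v\in\mathcal C_r(\mathbb R^d)$, then $K(v)\in\mathcal C_{r+1}(\mathbb R^d)$ and $|K(v)|_{r+1}\le C_r|v|_r^3$, where $C_r$ is a constant independent of $v$.
   Context: $\mathcal C_r(\mathbb R^d)$: continuous complex functions with finite norm $|f|_r=\sup_s|f(s)|\langle s\rangle^r$, $\langle s\rangle=(1+|s|^2)^{1/2}$. $\Sigma_*=\{z=(x,y)\in\mathbb R^d\times\mathbb R^d:x\cdot y=0, z\ne0\}$ with measure $\mu^\Sigma(dz)=|z|^{-1}dz|_{\Sigma_*}$, $dz|_{\Sigma_*}$ the Euclidean induced hypersurface volume. For $v:\mathbb R^d\to\mathbb C$ and $s\in\mathbb R^d$ the wave kinetic integral is $$K(v)(s)=2\pi\int_{\Sigma_*}\big(v_1v_2v_3+v_1v_2v_4-v_1v_3v_4-v_2v_3v_4\big)\mu^\Sigma(dz),$$ where $v_1=v(x+s)$, $v_2=v(y+s)$, $v_3=v(x+y+s)$, $v_4=v(s)$. *)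

theory Defs
  imports "HOL-Analysis.Analysis"
begin

definition jbr :: "'a::real_normed_vector \<Rightarrow> real" where
  "jbr s = sqrt (1 + (norm s)^2)"

definition in_Cr :: "real \<Rightarrow> ('a::real_normed_vector \<Rightarrow> complex) \<Rightarrow> bool" where
  "in_Cr r f \<longleftrightarrow> continuous_on UNIV f \<and> bdd_above (range (\<lambda>s. cmod (f s) * jbr s powr r))"

definition wnorm :: "real \<Rightarrow> ('a::real_normed_vector \<Rightarrow> complex) \<Rightarrow> real" where
  "wnorm r f = (SUP s. cmod (f s) * jbr s powr r)"

definition hausdorff_outer :: "real \<Rightarrow> 'a::metric_space set \<Rightarrow> ennreal" where
  "hausdorff_outer s A =
     (SUP \<delta>\<in>{0<..}. INF C\<in>{C :: nat \<Rightarrow> 'a set. A \<subseteq> (\<Union>i. C i) \<and>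
                                   (\<forall>i. bounded (C i) \<and> diameter (C i) < \<delta>)}.
        (\<Sum>i. ennreal (unit_ball_vol s / 2 powr s * diameter (C i) powr s)))"

definition Sigma_star :: "('a::euclidean_space \<times> 'a) set" where
  "Sigma_star = {z. fst z \<bullet> snd z = 0 \<and> z \<noteq> 0}"

text \<open>Induced hypersurface volume on Sigma_* (the (2d-1)-dim Hausdorff measure
  restricted to Sigma_*), as a Borel measure on R^d x R^d.\<close>

definition surface_Sigma :: "('a::euclidean_space \<times> 'a) measure" where
  "surface_Sigma = measure_of UNIV (sets borel)
     (\<lambda>A. hausdorff_outer (real (2 * DIM('a)) - 1) (A \<inter> Sigma_star))"

definition mu_Sigma :: "('a::euclidean_space \<times> 'a) measure" where
  "mu_Sigma = density surface_Sigma (\<lambda>z. ennreal (1 / norm z))"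

definition K_integrand :: "('a::euclidean_space \<Rightarrow> complex) \<Rightarrow> 'a \<Rightarrow> 'a \<times> 'a \<Rightarrow> complex" where
  "K_integrand v s z =
     (let x = fst z; y = snd z;
          v1 = v (x + s); v2 = v (y + s); v3 = v (x + y + s); v4 = v s
      in v1 * v2 * v3 + v1 * v2 * v4 - v1 * v3 * v4 - v2 * v3 * v4)"

definition wave_K :: "('a::euclidean_space \<Rightarrow> complex) \<Rightarrow> 'a \<Rightarrow> complex" where
  "wave_K v s = complex_of_real (2 * pi) * (LINT z|mu_Sigma. K_integrand v s z)"

end

theory Submission
  imports Defs
begin

text \<open>
  Only an upper bound for the hypersurface measure of the cone x \<bullet> y = 0 is needed. Where one
  coordinate of z = (x, y) dominates, the equation determines the conjugate coordinate as a
  Lipschitz function of the others, so grid coverings give the growth bound \<rho>^(2d-1) for balls of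
  radius \<rho>, and hence a measure of order 1 / (1 + |p|) for the unit ball around p. Averaging over unit
  balls therefore bounds integrals of slowly varying functions by Lebesgue integrals with weight
  1 / (1 + |p|) on the whole space; since r > d, the constraint x \<bullet> y = 0 can then be dropped. It is
  used once more in the integrand: s, s + x, s + x + y, s + y is a rectangle, so that each
  product of three values of v contains a factor of size \<langle>s\<rangle>^(-r), and the Lebesgue integral of
  the remaining two factors has order 1 / \<langle>s\<rangle>.
\<close>

section \<open>Covering the cone\<close>

text \<open>Reduces an upper bound to counting: at every scale it suffices to have finitely many
  cells with a common diameter bound \<open>e\<close>. Padding with empty sets, whose terms are 0,
  turns the finite cover into the sequence that the definition asks for.\<close>

lemma hausdorff_outer_le_finite_covers:
  fixes A :: "'a::metric_space set"
  assumes "s > 0"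
    and cover: "\<And>\<delta>. \<delta> > 0 \<Longrightarrow> \<exists>F e. finite F \<and> A \<subseteq> \<Union>F \<and> (\<forall>C\<in>F. bounded C \<and> diameter C \<le> e)
          \<and> e < \<delta> \<and> real (card F) * (unit_ball_vol s / 2 powr s * e powr s) \<le> M"
  shows "hausdorff_outer s A \<le> ennreal M"
  unfolding hausdorff_outer_def
proof (rule SUP_least)
  fix \<delta> :: real assume "\<delta> \<in> {0<..}"
  then have "\<delta> > 0" by simp
  then obtain F e where F: "finite F" "A \<subseteq> \<Union>F" "\<And>C. C \<in> F \<Longrightarrow> bounded C"
      "\<And>C. C \<in> F \<Longrightarrow> diameter C \<le> e" "e < \<delta>"
    and M: "real (card F) * (unit_ball_vol s / 2 powr s * e powr s) \<le> M"
    using cover[of \<delta>] by blast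
  define c where "c = unit_ball_vol s / 2 powr s"
  have "c \<ge> 0" using \<open>s > 0\<close> by (simp add: c_def)
  obtain f where f: "bij_betw f {0..<card F} F"
    using ex_bij_betw_nat_finite[OF F(1)] by blast
  define C where "C i = (if i < card F then f i else {})" for i
  have Cin: "C i \<in> F" if "i < card F" for i
    using that bij_betwE[OF f] by (simp add: C_def)
  have "\<Union>F \<subseteq> (\<Union>i. C i)"
  proof
    fix x assume "x \<in> \<Union>F"
    then obtain D where D: "D \<in> F" "x \<in> D" by blast
    then obtain i where "i < card F" "f i = D"
      by (metis atLeastLessThan_iff bij_betw_imp_surj_on[OF f] imageE)
    then show "x \<in> (\<Union>i. C i)" using D by (auto simp: C_def)
  qed
  moreover have "bounded (C i) \<and> diameter (C i) < \<delta>" for i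
  proof (cases "i < card F")
    case True then show ?thesis using F(3)[OF Cin[OF True]] F(4)[OF Cin[OF True]] F(5) by simp
  next
    case False then show ?thesis using \<open>\<delta> > 0\<close> by (simp add: C_def)
  qed
  ultimately have mem: "C \<in> {C. A \<subseteq> (\<Union>i. C i) \<and> (\<forall>i. bounded (C i) \<and> diameter (C i) < \<delta>)}"
    using F(2) by auto
  have "(\<Sum>i. ennreal (c * diameter (C i) powr s)) = (\<Sum>i<card F. ennreal (c * diameter (C i) powr s))"
    using \<open>s > 0\<close> by (intro suminf_finite) (auto simp: C_def)
  also have "\<dots> \<le> (\<Sum>i<card F. ennreal (c * e powr s))"
    using F(3,4) Cin \<open>c \<ge> 0\<close> \<open>s > 0\<close>
    by (intro sum_mono ennreal_leI mult_left_mono powr_mono2) (auto simp: diameter_ge_0)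
  also have "\<dots> = ennreal (real (card F) * (c * e powr s))"
    by (simp add: ennreal_of_nat_eq_real_of_nat ennreal_mult'' \<open>c \<ge> 0\<close>)
  also have "\<dots> \<le> ennreal M"
    using M by (intro ennreal_leI) (simp add: c_def)
  finally show "(INF C\<in>{C. A \<subseteq> (\<Union>i. C i) \<and> (\<forall>i. bounded (C i) \<and> diameter (C i) < \<delta>)}.
        (\<Sum>i. ennreal (unit_ball_vol s / 2 powr s * diameter (C i) powr s))) \<le> ennreal M"
    unfolding c_def by (rule INF_lower2[OF mem])
qed

text \<open>Swapping exchanges the basis vectors (i, 0) and (0, i), that is, the two coordinates x_i
  and y_i that meet in a term of x \<bullet> y. Such coordinates are called conjugate.\<close>

lemma swap_in_Basis [simp]: "prod.swap b \<in> Basis \<longleftrightarrow> b \<in> Basis"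
  for b :: "'a::euclidean_space \<times> 'a"
  by (cases b) (auto simp: Basis_prod_def)

lemma swap_neq_Basis: "b \<in> Basis \<Longrightarrow> prod.swap b \<noteq> b"
  for b :: "'a::euclidean_space \<times> 'a"
  by (cases b) (auto simp: Basis_prod_def)

text \<open>Each product x_i y_i occurs twice, once from (i, 0) and once from (0, i). In this form
  all 2d coordinates play the same role, so later arguments need not distinguish x from y.\<close>

lemma sum_Basis_mult_swap:
  fixes z :: "'a::euclidean_space \<times> 'a"
  shows "(\<Sum>b\<in>Basis. (z \<bullet> b) * (z \<bullet> prod.swap b)) = 2 * (fst z \<bullet> snd z)"
proof -
  have "(\<Sum>b\<in>Basis. (z \<bullet> b) * (z \<bullet> prod.swap b))
      = (\<Sum>i\<in>Basis. (z \<bullet> (i, 0)) * (z \<bullet> (0, i))) + (\<Sum>i\<in>Basis. (z \<bullet> (0, i)) * (z \<bullet> (i, 0)))"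
    unfolding Basis_prod_def
    by (subst sum.union_disjoint) (auto simp: sum.reindex inj_on_def)
  then show ?thesis
    by (simp add: euclidean_inner[of "fst z" "snd z"] inner_prod_def mult.commute)
qed

text \<open>Where the coordinate b is dominant, the equation x \<bullet> y = 0 can be solved for the
  conjugate coordinate, and the solution is 1-Lipschitz for the l1 norm.\<close>
lemma Sigma_graph_lipschitz:
  fixes z z' :: "'a::euclidean_space \<times> 'a"
  assumes b: "b \<in> Basis"
    and z: "fst z \<bullet> snd z = 0" "\<And>c. c \<in> Basis \<Longrightarrow> \<bar>z \<bullet> c\<bar> \<le> \<bar>z \<bullet> b\<bar>"
    and z': "fst z' \<bullet> snd z' = 0" "\<And>c. c \<in> Basis \<Longrightarrow> \<bar>z' \<bullet> c\<bar> \<le> \<bar>z' \<bullet> b\<bar>"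
  shows "\<bar>(z - z') \<bullet> prod.swap b\<bar> \<le> (\<Sum>c\<in>Basis - {prod.swap b}. \<bar>(z - z') \<bullet> c\<bar>)"
  using z z'
\<comment> \<open>By symmetry z may be taken as the point with the larger dominant coordinate. Then
  |z \<bullet> b| bounds all coordinates of both points and is the quantity to divide by.\<close>
proof (induction "\<bar>z' \<bullet> b\<bar>" "\<bar>z \<bullet> b\<bar>" arbitrary: z z' rule: linorder_wlog)
  case (sym z z')
  have "\<bar>(z' - z) \<bullet> c\<bar> = \<bar>(z - z') \<bullet> c\<bar>" for c
    by (simp add: inner_diff_left abs_minus_commute)
  then show ?case using sym(1)[OF refl refl sym(4,5,2,3)] by simp
next
  case (le z z')
  let ?s = "prod.swap :: 'a \<times> 'a \<Rightarrow> 'a \<times> 'a"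
  define R where "R = Basis - {b, ?s b}"
  define D where "D c = \<bar>(z - z') \<bullet> c\<bar>" for c
  have "?s c \<in> R" if "c \<in> R" for c
    using that unfolding R_def by (metis Diff_iff insert_iff empty_iff swap_in_Basis swap_swap)
  then have swR: "bij_betw ?s R R"
    by (intro bij_betw_byWitness[where f' = ?s]) auto
  have split: "(\<Sum>c\<in>Basis. f c) = f b + f (?s b) + (\<Sum>c\<in>R. f c)" for f :: "'a \<times> 'a \<Rightarrow> real"
  proof -
    have "Basis = insert b (insert (?s b) R)" using b by (auto simp: R_def)
    then have "sum f Basis = sum f (insert b (insert (?s b) R))" by simp
    also have "\<dots> = f b + f (?s b) + sum f R" using swap_neq_Basis[OF b] by (simp add: R_def)
    finally show ?thesis .
  qed
  \<comment> \<open>The conjugate pair of b contributes the same product twice, hence the factor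
    2.\<close>
  have eq: "2 * ((w \<bullet> b) * (w \<bullet> ?s b)) = - (\<Sum>c\<in>R. (w \<bullet> c) * (w \<bullet> ?s c))"
    if "fst w \<bullet> snd w = 0" for w
    using sum_Basis_mult_swap[of w] that by (subst (asm) split) (simp add: mult.commute)
  show ?case
  \<comment> \<open>If the dominant coordinate of z is 0, both points are the origin.\<close>
  proof (cases "z \<bullet> b = 0")
    case True
    then have "z \<bullet> ?s b = 0" "z' \<bullet> ?s b = 0"
      using le(1) le(3)[of "?s b"] le(5)[of "?s b"] b by auto
    then show ?thesis by (simp add: inner_diff_left sum_nonneg)
  next
    case False
    \<comment> \<open>The equations of z and z' are subtracted and each difference of products is
      split by u u' - w w' = u (u' - w') + (u - w) w'. \<open>S\<close> collects the pairs in
      \<open>R\<close>, and \<open>T\<close> the change of the coordinate b.\<close>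
    define S where "S = (\<Sum>c\<in>R. (z \<bullet> c) * ((z - z') \<bullet> ?s c) + ((z - z') \<bullet> c) * (z' \<bullet> ?s c))"
    define T where "T = 2 * ((z - z') \<bullet> b) * (z' \<bullet> ?s b)"
    have S_eq: "S = (\<Sum>c\<in>R. (z \<bullet> c) * (z \<bullet> ?s c)) - (\<Sum>c\<in>R. (z' \<bullet> c) * (z' \<bullet> ?s c))"
      unfolding S_def sum_subtractf[symmetric]
      by (intro sum.cong refl) (simp add: inner_diff_left algebra_simps)
    have "2 * (z \<bullet> b) * ((z - z') \<bullet> ?s b) =
        2 * ((z \<bullet> b) * (z \<bullet> ?s b)) - 2 * ((z' \<bullet> b) * (z' \<bullet> ?s b)) - T"
      by (simp add: T_def inner_diff_left algebra_simps)
    then have key: "2 * (z \<bullet> b) * ((z - z') \<bullet> ?s b) = - S - T"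
      unfolding eq[OF le(2)] eq[OF le(4)] S_eq by simp
    have "\<bar>S\<bar> \<le> (\<Sum>c\<in>R. \<bar>z \<bullet> b\<bar> * D (?s c) + \<bar>z \<bullet> b\<bar> * D c)"
      unfolding S_def
    proof (rule order_trans[OF sum_abs sum_mono])
      fix c assume "c \<in> R"
      then have c: "c \<in> Basis" "?s c \<in> Basis" by (auto simp: R_def)
      have "\<bar>(z \<bullet> c) * ((z - z') \<bullet> ?s c) + ((z - z') \<bullet> c) * (z' \<bullet> ?s c)\<bar>
          \<le> \<bar>z \<bullet> c\<bar> * D (?s c) + \<bar>z' \<bullet> ?s c\<bar> * D c"
        by (rule order_trans[OF abs_triangle_ineq]) (simp add: D_def abs_mult)
      also have "\<dots> \<le> \<bar>z \<bullet> b\<bar> * D (?s c) + \<bar>z \<bullet> b\<bar> * D c"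
        using le(3)[OF c(1)] le(5)[OF c(2)] le(1)
        by (intro add_mono mult_right_mono) (auto simp: D_def)
      finally show "\<bar>(z \<bullet> c) * ((z - z') \<bullet> ?s c) + ((z - z') \<bullet> c) * (z' \<bullet> ?s c)\<bar>
          \<le> \<bar>z \<bullet> b\<bar> * D (?s c) + \<bar>z \<bullet> b\<bar> * D c" .
    qed
    \<comment> \<open>Swapping permutes \<open>R\<close>, so both sums of increments agree. The
      resulting factor 2 matches the one in \<open>key\<close>, which is why the Lipschitz constant
      is 1.\<close>
    also have "\<dots> = 2 * \<bar>z \<bullet> b\<bar> * (\<Sum>c\<in>R. D c)"
      using sum.reindex_bij_betw[OF swR, of D] by (simp add: sum.distrib flip: sum_distrib_left)
    finally have S_le: "\<bar>S\<bar> \<le> 2 * \<bar>z \<bullet> b\<bar> * (\<Sum>c\<in>R. D c)" .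
    have "\<bar>z' \<bullet> ?s b\<bar> \<le> \<bar>z \<bullet> b\<bar>" using le(5)[of "?s b"] b le(1) by simp
    then have "D b * \<bar>z' \<bullet> ?s b\<bar> \<le> D b * \<bar>z \<bullet> b\<bar>"
      by (rule mult_left_mono) (simp add: D_def)
    then have T_le: "\<bar>T\<bar> \<le> 2 * \<bar>z \<bullet> b\<bar> * D b"
      by (simp add: T_def D_def abs_mult mult_ac)
    have "2 * \<bar>z \<bullet> b\<bar> * D (?s b) = \<bar>- S - T\<bar>"
      unfolding key[symmetric] by (simp add: D_def abs_mult)
    also have "\<dots> \<le> \<bar>S\<bar> + \<bar>T\<bar>" by linarith
    also have "\<dots> \<le> 2 * \<bar>z \<bullet> b\<bar> * ((\<Sum>c\<in>R. D c) + D b)"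
      using S_le T_le by (simp add: algebra_simps)
    finally have "2 * \<bar>z \<bullet> b\<bar> * D (?s b) \<le> 2 * \<bar>z \<bullet> b\<bar> * ((\<Sum>c\<in>R. D c) + D b)" .
    then have "D (?s b) \<le> (\<Sum>c\<in>R. D c) + D b"
      using False by simp
    also have "\<dots> = (\<Sum>c\<in>Basis - {?s b}. D c)"
    proof -
      have "Basis - {?s b} = insert b R" using b swap_neq_Basis[OF b] by (auto simp: R_def)
      then have "sum D (Basis - {?s b}) = sum D (insert b R)" by simp
      also have "\<dots> = D b + sum D R" by (simp add: R_def)
      finally show ?thesis by simp
    qed
    finally show ?thesis by (simp add: D_def)
  qed
qed

text \<open>For each of the 2d choices of a dominant coordinate, a grid of mesh \<rho> / n is laid
  in all coordinates but the conjugate one, which the Lipschitz bound controls. This gives of order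
  n^(2d-1) cells of diameter of order \<rho> / n, and n cancels.\<close>

lemma hausdorff_outer_Sigma_cball_le:
  fixes p :: "'a::euclidean_space \<times> 'a"
  defines "m \<equiv> 2 * DIM('a) - 1"
  assumes "\<rho> > 0"
  shows "hausdorff_outer (real (2 * DIM('a)) - 1) (Sigma_star \<inter> cball p \<rho>)
    \<le> ennreal (2 * DIM('a) * (unit_ball_vol (real m) / 2 powr real m * (12 * real DIM('a)) ^ m) * \<rho> ^ m)"
proof -
  let ?s = "prod.swap :: 'a \<times> 'a \<Rightarrow> 'a \<times> 'a"
  have "DIM('a) \<ge> 1" using DIM_positive[where 'a='a] by linarith
  then have m: "m > 0" "real (2 * DIM('a)) - 1 = real m"
    unfolding m_def by linarith+
  define c where "c = unit_ball_vol (real m) / 2 powr real m"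
  have c: "c \<ge> 0" by (simp add: c_def)
  show ?thesis
    unfolding m(2)
  proof (rule hausdorff_outer_le_finite_covers)
    show "real m > 0" using m by simp
    fix \<delta> :: real assume "\<delta> > 0"
    obtain n :: nat where n: "4 * DIM('a) * \<rho> / \<delta> < n" using reals_Archimedean2 by blast
    moreover have "4 * DIM('a) * \<rho> / \<delta> > 0" using \<open>\<rho> > 0\<close> \<open>\<delta> > 0\<close> by simp
    ultimately have "n > 0" by (metis less_trans of_nat_0_less_iff)
    \<comment> \<open>The l1 norm of a difference within a cell is at most 2 * 2d * \<rho> / n: a
      factor 2 from the Lipschitz bound, and fewer than 2d grid coordinates. The choice of n makes
      this smaller than \<delta>.\<close>
    define e where "e = 4 * DIM('a) * \<rho> / n"
    have e: "e < \<delta>" "e > 0" using n \<open>n > 0\<close> \<open>\<delta> > 0\<close> \<open>\<rho> > 0\<close> by (auto simp: e_def field_simps)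
    \<comment> \<open>Index of the slab of width \<rho> / n that contains z in direction c. The
      offset \<rho> makes it nonnegative on the ball, and since the endpoint 2n can be attained
      there are 2n + 1 values.\<close>
    define k where "k z c = nat \<lfloor>(z \<bullet> c - p \<bullet> c + \<rho>) * n / \<rho>\<rfloor>" for z c :: "'a \<times> 'a"
    define cell where "cell b \<kappa> = {z \<in> Sigma_star \<inter> cball p \<rho>.
        (\<forall>c\<in>Basis. \<bar>z \<bullet> c\<bar> \<le> \<bar>z \<bullet> b\<bar>) \<and> (\<forall>c\<in>Basis - {?s b}. k z c = \<kappa> c)}"
      for b :: "'a \<times> 'a" and \<kappa> :: "'a \<times> 'a \<Rightarrow> nat"
    define I where "I = (SIGMA b : (Basis :: ('a \<times> 'a) set). PiE (Basis - {?s b}) (\<lambda>_. {0..2*n}))"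
    have coord: "0 \<le> (z \<bullet> c - p \<bullet> c + \<rho>) * n / \<rho>" "(z \<bullet> c - p \<bullet> c + \<rho>) * n / \<rho> \<le> 2 * n"
      if "z \<in> cball p \<rho>" "c \<in> Basis" for z c
    proof -
      have "\<bar>(z - p) \<bullet> c\<bar> \<le> norm (z - p)" using that(2) by (rule Basis_le_norm)
      also have "\<dots> \<le> \<rho>" using that(1) by (simp add: dist_norm norm_minus_commute)
      finally have *: "\<bar>z \<bullet> c - p \<bullet> c\<bar> \<le> \<rho>" by (simp add: inner_diff_left)
      then show "0 \<le> (z \<bullet> c - p \<bullet> c + \<rho>) * n / \<rho>" using \<open>\<rho> > 0\<close> by simp
      have "(z \<bullet> c - p \<bullet> c + \<rho>) * n \<le> (2 * \<rho>) * n" by (rule mult_right_mono) (use * in auto)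
      then show "(z \<bullet> c - p \<bullet> c + \<rho>) * n / \<rho> \<le> 2 * n"
        using \<open>\<rho> > 0\<close> by (simp add: field_simps)
    qed
    have finI: "finite I" unfolding I_def by (intro finite_SigmaI finite_PiE) auto
    have "card I = (\<Sum>b\<in>(Basis :: ('a \<times> 'a) set). card (PiE (Basis - {?s b}) (\<lambda>_. {0..2*n})))"
      unfolding I_def by (rule card_SigmaI) (auto intro!: finite_PiE)
    also have "\<dots> = (\<Sum>b\<in>(Basis :: ('a \<times> 'a) set). (2 * n + 1) ^ m)"
      by (intro sum.cong refl) (simp add: card_PiE card_Diff_singleton m_def mult_2)
    also have "\<dots> = 2 * DIM('a) * (2 * n + 1) ^ m" by simp
    finally have cardI: "card I = \<dots>" .
    have dist: "norm (z - z') \<le> e" if "z \<in> cell b \<kappa>" "z' \<in> cell b \<kappa>" "b \<in> Basis" for z z' b \<kappa>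
    proof -
      have close: "\<bar>(z - z') \<bullet> c\<bar> \<le> \<rho> / n" if "c \<in> Basis - {?s b}" for c
      proof -
        have zz: "z \<in> cball p \<rho>" "z' \<in> cball p \<rho>" "k z c = k z' c"
          using that \<open>z \<in> cell b \<kappa>\<close> \<open>z' \<in> cell b \<kappa>\<close> by (auto simp: cell_def)
        have "\<lfloor>(z \<bullet> c - p \<bullet> c + \<rho>) * n / \<rho>\<rfloor> = \<lfloor>(z' \<bullet> c - p \<bullet> c + \<rho>) * n / \<rho>\<rfloor>"
          using zz(3) coord(1)[OF zz(1)] coord(1)[OF zz(2)] that unfolding k_def
          by (subst (asm) eq_nat_nat_iff) auto
        then have "\<bar>(z \<bullet> c - p \<bullet> c + \<rho>) * n / \<rho> - (z' \<bullet> c - p \<bullet> c + \<rho>) * n / \<rho>\<bar> \<le> 1"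
          by linarith
        also have "(z \<bullet> c - p \<bullet> c + \<rho>) * n / \<rho> - (z' \<bullet> c - p \<bullet> c + \<rho>) * n / \<rho> = ((z - z') \<bullet> c) * (n / \<rho>)"
          using \<open>\<rho> > 0\<close> by (simp add: inner_diff_left field_simps)
        finally have "\<bar>(z - z') \<bullet> c\<bar> * (n / \<rho>) \<le> 1"
          using \<open>\<rho> > 0\<close> by (simp add: abs_mult)
        then show ?thesis using \<open>\<rho> > 0\<close> \<open>n > 0\<close> by (simp add: field_simps)
      qed
      have "norm (z - z') \<le> (\<Sum>c\<in>Basis. \<bar>(z - z') \<bullet> c\<bar>)" by (rule norm_le_l1)
      also have "\<dots> = \<bar>(z - z') \<bullet> ?s b\<bar> + (\<Sum>c\<in>Basis - {?s b}. \<bar>(z - z') \<bullet> c\<bar>)"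
        using \<open>b \<in> Basis\<close> by (intro sum.remove) auto
      also have "\<dots> \<le> 2 * (\<Sum>c\<in>Basis - {?s b}. \<bar>(z - z') \<bullet> c\<bar>)"
        using Sigma_graph_lipschitz[OF \<open>b \<in> Basis\<close>, of z z'] that by (auto simp: cell_def Sigma_star_def)
      also have "(\<Sum>c\<in>Basis - {?s b}. \<bar>(z - z') \<bullet> c\<bar>) \<le> (\<Sum>c\<in>Basis - {?s b}. \<rho> / n)"
        by (rule sum_mono) (rule close)
      also have "\<dots> \<le> (\<Sum>c\<in>(Basis :: ('a \<times> 'a) set). \<rho> / n)"
        using \<open>\<rho> > 0\<close> by (intro sum_mono2) auto
      finally show ?thesis by (simp add: e_def)
    qed
    define F where "F = (\<lambda>(b, \<kappa>). cell b \<kappa>) ` I"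
    have "Sigma_star \<inter> cball p \<rho> \<subseteq> \<Union>F"
    proof
      fix z assume z: "z \<in> Sigma_star \<inter> cball p \<rho>"
      obtain b where b: "b \<in> Basis" "Max ((\<lambda>c. \<bar>z \<bullet> c\<bar>) ` Basis) = \<bar>z \<bullet> b\<bar>"
        by (rule obtains_MAX[of Basis "\<lambda>c. \<bar>z \<bullet> c\<bar>"]) auto
      have b_max: "\<bar>z \<bullet> c\<bar> \<le> \<bar>z \<bullet> b\<bar>" if "c \<in> Basis" for c
        unfolding b(2)[symmetric] using that by (intro Max_ge) auto
      define \<kappa> where "\<kappa> = restrict (k z) (Basis - {?s b})"
      have "k z c \<le> 2 * n" if "c \<in> Basis" for c
        using coord[of z c] that z unfolding k_def by (simp add: nat_le_iff floor_le_iff)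
      then have "(b, \<kappa>) \<in> I" using b by (auto simp: I_def \<kappa>_def)
      moreover have "z \<in> cell b \<kappa>" using z b_max by (auto simp: cell_def \<kappa>_def)
      ultimately show "z \<in> \<Union>F"
        unfolding F_def by (intro UnionI[of "cell b \<kappa>"] image_eqI[of _ _ "(b, \<kappa>)"]) auto
    qed
    moreover have "bounded C \<and> diameter C \<le> e" if "C \<in> F" for C
    proof -
      obtain b \<kappa> where C: "C = cell b \<kappa>" "b \<in> Basis" using \<open>C \<in> F\<close> by (auto simp: F_def I_def)
      have "cell b \<kappa> \<subseteq> cball p \<rho>" by (auto simp: cell_def)
      then have "bounded C" unfolding C by (rule bounded_subset[OF bounded_cball])
      moreover have "diameter C \<le> e"
        using e(2) dist[of _ b \<kappa>] C by (intro diameter_le) auto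
      ultimately show ?thesis by blast
    qed
    moreover have "real (card F) * (c * e powr real m) \<le> 2 * DIM('a) * (c * (12 * real DIM('a)) ^ m) * \<rho> ^ m"
    proof -
      have "real (card F) \<le> real (card I)" unfolding F_def by (intro of_nat_mono card_image_le finI)
      also have "\<dots> = 2 * DIM('a) * (2 * real n + 1) ^ m" unfolding cardI by (simp add: add.commute)
      \<comment> \<open>With 2n + 1 \<le> 3n the product 3 n e equals 12 d \<rho>, so the final
        bound is independent of the grid.\<close>
      also have "\<dots> \<le> 2 * DIM('a) * (3 * real n) ^ m"
        using \<open>n > 0\<close> by (intro mult_left_mono power_mono) auto
      finally have "real (card F) * (c * e powr real m) \<le> 2 * DIM('a) * (3 * real n) ^ m * (c * e ^ m)"
        using c e by (simp add: powr_realpow mult_right_mono)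
      also have "\<dots> = 2 * DIM('a) * c * (3 * real n * e) ^ m" by (simp add: power_mult_distrib)
      also have "3 * real n * e = 12 * DIM('a) * \<rho>" using \<open>n > 0\<close> by (simp add: e_def)
      finally show ?thesis by (simp add: power_mult_distrib algebra_simps)
    qed
    ultimately show "\<exists>F e. finite F \<and> Sigma_star \<inter> cball p \<rho> \<subseteq> \<Union>F \<and>
        (\<forall>C\<in>F. bounded C \<and> diameter C \<le> e) \<and> e < \<delta> \<and>
        real (card F) * (unit_ball_vol (real m) / 2 powr real m * e powr real m)
         \<le> 2 * DIM('a) * (unit_ball_vol (real m) / 2 powr real m * (12 * real DIM('a)) ^ m) * \<rho> ^ m"
      using finI e(1) unfolding c_def[symmetric] by (intro exI[of _ F] exI[of _ e]) (simp add: F_def)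
  qed
qed

section \<open>Unit balls and averaging\<close>

lemma sets_surface_Sigma [simp, measurable_cong]: "sets surface_Sigma = sets borel"
  using sets.sets_measure_of_eq[of borel] by (simp add: surface_Sigma_def)

lemma sets_mu_Sigma [simp, measurable_cong]: "sets mu_Sigma = sets borel"
  by (simp add: mu_Sigma_def)

lemma space_mu_Sigma [simp]: "space mu_Sigma = UNIV"
  using sets_eq_imp_space_eq[OF sets_mu_Sigma] by simp

text \<open>Only an upper bound is needed, so it is irrelevant whether the Hausdorff set function is
  countably additive: otherwise measure_of yields the null measure.\<close>
lemma emeasure_surface_Sigma_le:
  fixes A :: "('a::euclidean_space \<times> 'a) set"
  shows "emeasure surface_Sigma A \<le> hausdorff_outer (real (2 * DIM('a)) - 1) (A \<inter> Sigma_star)"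
  by (simp add: surface_Sigma_def emeasure_measure_of_conv)

lemma borel_Sigma_star [measurable]: "(Sigma_star :: ('a::euclidean_space \<times> 'a) set) \<in> sets borel"
proof -
  have eq: "Sigma_star = {z :: 'a \<times> 'a. fst z \<bullet> snd z = 0} - {0}"
    by (simp add: Sigma_star_def set_diff_eq)
  show ?thesis
    unfolding eq by (intro sets.Diff borel_closed closed_Collect_eq closed_singleton continuous_intros)
qed

lemma hausdorff_outer_empty: "s > 0 \<Longrightarrow> hausdorff_outer s {} = 0"
  using hausdorff_outer_le_finite_covers[of s "{}" 0]
  by (metis Sup_empty card.empty ennreal_0 empty_iff finite.emptyI le_zero_eq mult_zero_left
      of_nat_0 order_refl)

text \<open>The complement of the cone is bounded by the outer measure of the empty set. This makes
  the relation x \<bullet> y = 0 available almost everywhere under the integral.\<close>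

lemma AE_surface_Sigma:
  "AE z in (surface_Sigma :: ('a::euclidean_space \<times> 'a) measure). z \<in> Sigma_star"
proof (rule AE_I')
  have "real (2 * DIM('a)) - 1 > 0"
    using DIM_positive[where 'a='a] by linarith
  then have "emeasure surface_Sigma (- Sigma_star :: ('a \<times> 'a) set) = 0"
    using emeasure_surface_Sigma_le[of "- Sigma_star :: ('a \<times> 'a) set"]
    by (simp add: hausdorff_outer_empty)
  moreover have "- Sigma_star \<in> sets (borel :: ('a \<times> 'a) measure)"
    using borel_Sigma_star by (rule borel_comp)
  ultimately show "- Sigma_star \<in> null_sets (surface_Sigma :: ('a \<times> 'a) measure)"
    by auto
qed auto

lemma AE_mu_Sigma: "AE z in mu_Sigma. z \<in> Sigma_star"
  unfolding mu_Sigma_def using AE_surface_Sigma by (subst AE_density) auto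

lemma surface_Sigma_cball_le:
  obtains c :: real where "c \<ge> 0"
    "\<And>(p :: 'a::euclidean_space \<times> 'a) \<rho>. \<rho> > 0 \<Longrightarrow>
       emeasure surface_Sigma (cball p \<rho>) \<le> ennreal (c * \<rho> ^ (2 * DIM('a) - 1))"
proof (rule that)
  fix p :: "'a \<times> 'a" and \<rho> :: real assume "\<rho> > 0"
  then show "emeasure surface_Sigma (cball p \<rho>) \<le> ennreal (2 * DIM('a) *
      (unit_ball_vol (real (2 * DIM('a) - 1)) / 2 powr real (2 * DIM('a) - 1) *
      (12 * real DIM('a)) ^ (2 * DIM('a) - 1)) * \<rho> ^ (2 * DIM('a) - 1))"
    using order_trans[OF emeasure_surface_Sigma_le[of "cball p \<rho>"]]
      hausdorff_outer_Sigma_cball_le[of \<rho> p] by (simp only: Int_commute)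
qed (intro mult_nonneg_nonneg divide_nonneg_nonneg unit_ball_vol_nonneg zero_le_power of_nat_0_le_iff powr_ge_zero, simp_all)

section \<open>Measure of unit balls with the density 1 / |z|\<close>

lemma le_suminf_ennreal: "f k \<le> (\<Sum>k. f k)" for f :: "nat \<Rightarrow> ennreal"
  using sum_le_suminf[of f "{k}"] by simp

text \<open>The singularity of the density at the vertex is summed over dyadic shells: on the k-th
  one 1 / |z| has order 2^k, while the surrounding ball has surface measure of order 2^(-k m) with m
  = 2d - 1 \<ge> 2.\<close>

lemma mu_Sigma_cball_origin_finite:
  assumes "DIM('a::euclidean_space) \<ge> 2"
  shows "emeasure mu_Sigma (cball (0 :: 'a \<times> 'a) 3) < \<infinity>"
proof -
  obtain c where c: "c \<ge> 0" and ball: "\<And>(p :: 'a \<times> 'a) \<rho>. \<rho> > 0 \<Longrightarrow>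
       emeasure surface_Sigma (cball p \<rho>) \<le> ennreal (c * \<rho> ^ (2 * DIM('a) - 1))"
    using surface_Sigma_cball_le by blast
  define m where "m = 2 * DIM('a) - 1"
  have m: "m \<ge> 2" using assms by (simp add: m_def)
  define B :: "nat \<Rightarrow> ('a \<times> 'a) set" where "B k = cball 0 (3 / 2 ^ k)" for k
  have [measurable]: "B k \<in> sets borel" for k by (simp add: B_def)
  have shell: "ennreal (1 / norm z) * indicator (cball 0 3) z \<le> (\<Sum>k. ennreal (2 ^ Suc k) * indicator (B k) z)"
    for z :: "'a \<times> 'a"
  \<comment> \<open>At the origin \<open>1 / norm z\<close> is 0 by convention, so only nonzero
    points need a shell.\<close>
  proof (cases "z = 0 \<or> z \<notin> cball 0 3")
    case False
    then have z: "z \<noteq> 0" "norm z \<le> 3" by auto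
    obtain k where "3 / norm z < 2 ^ k" using real_arch_pow[of 2] by auto
    then have ex: "\<exists>k. 3 / 2 ^ k < norm z"
      using z(1) by (intro exI[of _ k]) (simp add: field_simps)
    \<comment> \<open>The least index is some k + 1, and then 3 / 2^(k+1) < |z| \<le> 3 /
      2^k.\<close>
    define j where "j = (LEAST k. 3 / 2 ^ k < norm z)"
    have j: "3 / 2 ^ j < norm z" unfolding j_def using LeastI_ex[OF ex] .
    then have "j \<noteq> 0" using z(2) by (intro notI) simp
    then obtain k where k: "j = Suc k" using not0_implies_Suc by blast
    have "k < (LEAST k. 3 / 2 ^ k < norm z)" using k by (simp add: j_def)
    then have "\<not> 3 / 2 ^ k < norm z" by (rule not_less_Least)
    then have "z \<in> B k" by (simp add: B_def)
    have "1 / norm z \<le> 1 / (3 / 2 ^ Suc k)"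
      using j k z by (intro divide_left_mono) auto
    also have "\<dots> \<le> 2 ^ Suc k" by simp
    finally have "ennreal (1 / norm z) * indicator (cball 0 3) z \<le> ennreal (2 ^ Suc k) * indicator (B k) z"
      using \<open>z \<in> B k\<close> z by (simp add: ennreal_leI)
    also have "\<dots> \<le> (\<Sum>k. ennreal (2 ^ Suc k) * indicator (B k) z)"
      by (rule le_suminf_ennreal)
    finally show ?thesis .
  qed auto
  have "emeasure mu_Sigma (cball (0 :: 'a \<times> 'a) 3)
      = (\<integral>\<^sup>+z. ennreal (1 / norm z) * indicator (cball (0 :: 'a \<times> 'a) 3) z \<partial>surface_Sigma)"
    unfolding mu_Sigma_def by (subst emeasure_density) auto
  also have "\<dots> \<le> (\<integral>\<^sup>+z. (\<Sum>k. ennreal (2 ^ Suc k) * indicator (B k) z) \<partial>surface_Sigma)"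
    by (rule nn_integral_mono) (rule shell)
  also have "\<dots> = (\<Sum>k. ennreal (2 ^ Suc k) * emeasure surface_Sigma (B k))"
    by (subst nn_integral_suminf) (simp_all add: nn_integral_cmult_indicator)
  also have "\<dots> \<le> (\<Sum>k. ennreal (2 * c * 3 ^ m * (1 / 2) ^ k))"
  proof (intro suminf_le summableI)
    fix k
    have "ennreal (2 ^ Suc k) * emeasure surface_Sigma (B k) \<le> ennreal (2 ^ Suc k) * ennreal (c * (3 / 2 ^ k) ^ m)"
      unfolding B_def m_def by (intro mult_left_mono ball) auto
    also have "\<dots> = ennreal (2 * c * 3 ^ m * (2 ^ k * (1 / 2 ^ k) ^ m))"
      using c by (subst ennreal_mult[symmetric]) (auto simp: power_divide)
    \<comment> \<open>Lowering the exponent m to 2 leaves a geometric series of ratio 1/2.\<close>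
    also have "\<dots> \<le> ennreal (2 * c * 3 ^ m * (2 ^ k * (1 / 2 ^ k) ^ 2))"
      using c m by (intro ennreal_leI mult_left_mono power_decreasing) auto
    also have "2 ^ k * (1 / 2 ^ k) ^ 2 = (1 / 2 :: real) ^ k"
      by (simp add: power2_eq_square power_divide)
    finally show "ennreal (2 ^ Suc k) * emeasure surface_Sigma (B k) \<le> ennreal (2 * c * 3 ^ m * (1 / 2) ^ k)" .
  qed
  also have "\<dots> < \<infinity>"
    using c by (subst suminf_ennreal2) (auto intro!: summable_mult summable_geometric)
  finally show ?thesis .
qed

text \<open>For |p| \<ge> 2 the density is of order 1 / (1 + |p|) on the whole ball and the surface
  measure of the ball is bounded. For smaller |p| the ball lies in the ball of radius 3 around the
  origin, which has finite measure.\<close>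

lemma mu_Sigma_ball_le:
  assumes "DIM('a::euclidean_space) \<ge> 2"
  obtains c :: real where "c \<ge> 0"
    "\<And>p :: 'a \<times> 'a. emeasure mu_Sigma (ball p 1) \<le> ennreal (c / (1 + norm p))"
proof -
  obtain c where c: "c \<ge> 0" and cball: "\<And>(p :: 'a \<times> 'a) \<rho>. \<rho> > 0 \<Longrightarrow>
       emeasure surface_Sigma (cball p \<rho>) \<le> ennreal (c * \<rho> ^ (2 * DIM('a) - 1))"
    using surface_Sigma_cball_le by blast
  obtain c0 where c0: "c0 \<ge> 0" "emeasure mu_Sigma (cball (0 :: 'a \<times> 'a) 3) = ennreal c0"
    using mu_Sigma_cball_origin_finite[OF assms] by (metis ennreal_cases infinity_ennreal_def less_irrefl)
  have "emeasure mu_Sigma (ball p 1) \<le> ennreal (3 * (c + c0) / (1 + norm p))" for p :: "'a \<times> 'a"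
  proof (cases "norm p < 2")
    case True
    have "ball p 1 \<subseteq> cball 0 3"
    proof
      fix z assume "z \<in> ball p 1"
      then show "z \<in> cball 0 3" using True norm_triangle_sub[of z p]
        by (simp add: dist_norm norm_minus_commute)
    qed
    then have "emeasure mu_Sigma (ball p 1) \<le> ennreal c0"
      unfolding c0(2)[symmetric] by (intro emeasure_mono) auto
    also have "c0 \<le> 3 * (c + c0) / (1 + norm p)"
    proof -
      have "c0 * (1 + norm p) \<le> c0 * 3" using True c0 by (intro mult_left_mono) auto
      moreover have "0 < 1 + norm p" by (simp add: add_pos_nonneg)
      ultimately show ?thesis using c by (simp add: pos_le_divide_eq)
    qed
    finally show ?thesis by (simp add: ennreal_leI)
  next
    case False
    have "emeasure mu_Sigma (ball p 1) = (\<integral>\<^sup>+z. ennreal (1 / norm z) * indicator (ball p 1) z \<partial>surface_Sigma)"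
      unfolding mu_Sigma_def by (subst emeasure_density) auto
    also have "\<dots> \<le> (\<integral>\<^sup>+z. ennreal (3 / (1 + norm p)) * indicator (cball p 1) z \<partial>surface_Sigma)"
    proof (rule nn_integral_mono)
      fix z :: "'a \<times> 'a"
      \<comment> \<open>For |p| \<ge> 2 one has |z| > |p| - 1 \<ge> (1 + |p|) / 3.\<close>
      have "1 / norm z \<le> 3 / (1 + norm p)" if "dist p z < 1"
      proof -
        have "norm z > norm p - 1"
          using that norm_triangle_sub[of p z] by (simp add: dist_norm)
        moreover from this have "norm z > 0" using False by linarith
        moreover have "0 < 1 + norm p" by (simp add: add_pos_nonneg)
        ultimately show ?thesis using False by (simp add: field_simps)
      qed
      then show "ennreal (1 / norm z) * indicator (ball p 1) z \<le> ennreal (3 / (1 + norm p)) * indicator (cball p 1) z"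
        by (auto simp: indicator_def intro!: ennreal_leI)
    qed
    also have "\<dots> = ennreal (3 / (1 + norm p)) * emeasure surface_Sigma (cball p 1)"
      by (subst nn_integral_cmult_indicator) auto
    also have "\<dots> \<le> ennreal (3 / (1 + norm p)) * ennreal c"
      using cball[of 1 p] by (intro mult_left_mono) auto
    also have "\<dots> = ennreal (3 * c / (1 + norm p))"
      using c by (subst ennreal_mult[symmetric]) auto
    also have "\<dots> \<le> ennreal (3 * (c + c0) / (1 + norm p))"
      using c c0 by (intro ennreal_leI divide_right_mono) auto
    finally show ?thesis .
  qed
  then show thesis using c c0 by (intro that[of "3 * (c + c0)"]) auto
qed

text \<open>Unit balls around a countable dense set cover the space and have finite measure. The
  exchange of integrals in the averaging argument relies on this.\<close>

lemma sigma_finite_mu_Sigma: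
  assumes "DIM('a::euclidean_space) \<ge> 2"
  shows "sigma_finite_measure (mu_Sigma :: ('a \<times> 'a) measure)"
proof -
  obtain c where c: "\<And>p :: 'a \<times> 'a. emeasure mu_Sigma (ball p 1) \<le> ennreal (c / (1 + norm p))"
    using mu_Sigma_ball_le[OF assms] by blast
  obtain D :: "('a \<times> 'a) set" where D: "countable D" "\<And>X. open X \<Longrightarrow> X \<noteq> {} \<Longrightarrow> \<exists>d\<in>D. d \<in> X"
    using countable_dense_setE by blast
  show ?thesis
  proof (standard, intro exI conjI)
    show "countable ((\<lambda>p. ball p 1) ` D)" using D(1) by simp
    have "z \<in> \<Union>((\<lambda>p. ball p 1) ` D)" for z
      using D(2)[of "ball z 1"] by (auto simp: dist_commute)
    then show "\<Union>((\<lambda>p. ball p 1) ` D) = space mu_Sigma" by auto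
    show "\<forall>a\<in>(\<lambda>p. ball p 1) ` D. emeasure mu_Sigma a \<noteq> \<infinity>"
    proof
      fix a assume "a \<in> (\<lambda>p. ball p 1) ` D"
      then obtain p where "a = ball p 1" by blast
      then have "emeasure mu_Sigma a \<le> ennreal (c / (1 + norm p))" using c[of p] by simp
      then show "emeasure mu_Sigma a \<noteq> \<infinity>" by (auto simp: top_unique)
    qed
  qed auto
qed

text \<open>Averaging over the unit ball around each point trades the surface measure for Lebesgue
  measure with the weight that bounds the surface measure of unit balls.\<close>
lemma nn_integral_mu_Sigma_le:
  fixes a :: real
  assumes "DIM('a::euclidean_space) \<ge> 2" and "a \<ge> 0"
  obtains c :: real where "c \<ge> 0"
    "\<And>g :: 'a \<times> 'a \<Rightarrow> real. g \<in> borel_measurable borel \<Longrightarrow> (\<And>z. g z \<ge> 0) \<Longrightarrow>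
       (\<And>z p. dist z p < 1 \<Longrightarrow> g z \<le> a * g p) \<Longrightarrow>
       (\<integral>\<^sup>+z. g z \<partial>mu_Sigma) \<le> ennreal c * (\<integral>\<^sup>+p. g p / (1 + norm p) \<partial>lborel)"
proof -
  obtain c where c: "c \<ge> 0" "\<And>p :: 'a \<times> 'a. emeasure mu_Sigma (ball p 1) \<le> ennreal (c / (1 + norm p))"
    using mu_Sigma_ball_le[OF assms(1)] by blast
  interpret mu: sigma_finite_measure "mu_Sigma :: ('a \<times> 'a) measure"
    by (rule sigma_finite_mu_Sigma[OF assms(1)])
  interpret pair_sigma_finite "mu_Sigma :: ('a \<times> 'a) measure" "lborel :: ('a \<times> 'a) measure" ..
  define V where "V = unit_ball_vol (real DIM('a \<times> 'a))"
  have V: "V > 0" by (simp add: V_def)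
  have ball: "emeasure lborel (ball z 1) = ennreal V" for z :: "'a \<times> 'a"
    by (simp add: V_def emeasure_ball)
  show thesis
  proof (rule that[of "a * c / V"])
    show "a * c / V \<ge> 0" using c V assms by simp
    fix g :: "'a \<times> 'a \<Rightarrow> real"
    assume g [measurable]: "g \<in> borel_measurable borel" and nn: "\<And>z. g z \<ge> 0"
      and slow: "\<And>z p. dist z p < 1 \<Longrightarrow> g z \<le> a * g p"
    define S where "S = {w :: ('a \<times> 'a) \<times> ('a \<times> 'a). dist (fst w) (snd w) < 1}"
    \<comment> \<open>Integrating \<open>F z\<close> over p gives V times g z. After the integrals
      are exchanged, p is fixed and z runs over the unit ball around p, where g z \<le> a g p and
      the measure of the ball supplies the weight.\<close>
    define F where "F z p = ennreal (g z) * indicator S (z, p)" for z p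
    have "open S" unfolding S_def by (intro open_Collect_less continuous_intros)
    then have [measurable]: "S \<in> sets (borel \<Otimes>\<^sub>M borel)" unfolding borel_prod by simp
    have "case_prod F \<in> borel_measurable (borel \<Otimes>\<^sub>M borel)"
      unfolding F_def by measurable
    also have "borel_measurable (borel \<Otimes>\<^sub>M borel) = borel_measurable ((mu_Sigma :: ('a \<times> 'a) measure) \<Otimes>\<^sub>M (lborel :: ('a \<times> 'a) measure))"
      by (intro measurable_cong_sets sets_pair_measure_cong) simp_all
    finally have F_meas: "case_prod F \<in> borel_measurable ((mu_Sigma :: ('a \<times> 'a) measure) \<Otimes>\<^sub>M lborel)" .
    have "ennreal V * (\<integral>\<^sup>+z. g z \<partial>mu_Sigma) = (\<integral>\<^sup>+z. ennreal (g z) * ennreal V \<partial>mu_Sigma)"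
      by (subst nn_integral_cmult[symmetric]) (simp_all add: mult.commute)
    also have "\<dots> = (\<integral>\<^sup>+z. (\<integral>\<^sup>+p. F z p \<partial>lborel) \<partial>mu_Sigma)"
    proof (rule nn_integral_cong)
      fix z
      have "F z p = ennreal (g z) * indicator (ball z 1) p" for p
        by (simp add: F_def S_def indicator_def)
      then show "ennreal (g z) * ennreal V = (\<integral>\<^sup>+p. F z p \<partial>lborel)"
        by (simp add: nn_integral_cmult_indicator ball)
    qed
    also have "\<dots> = (\<integral>\<^sup>+p. (\<integral>\<^sup>+z. F z p \<partial>mu_Sigma) \<partial>lborel)"
      by (rule Fubini'[OF F_meas, symmetric])
    also have "\<dots> \<le> (\<integral>\<^sup>+p. ennreal (a * c) * ennreal (g p / (1 + norm p)) \<partial>lborel)"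
    proof (rule nn_integral_mono)
      fix p :: "'a \<times> 'a"
      have "F z p \<le> ennreal (a * g p) * indicator (ball p 1) z" for z
        using slow[of z p] by (simp add: F_def S_def indicator_def dist_commute ennreal_leI)
      then have "(\<integral>\<^sup>+z. F z p \<partial>mu_Sigma) \<le> (\<integral>\<^sup>+z. ennreal (a * g p) * indicator (ball p 1) z \<partial>mu_Sigma)"
        by (intro nn_integral_mono) simp
      also have "\<dots> = ennreal (a * g p) * emeasure mu_Sigma (ball p 1)"
        by (subst nn_integral_cmult_indicator) auto
      also have "\<dots> \<le> ennreal (a * g p) * ennreal (c / (1 + norm p))"
        by (intro mult_left_mono c) auto
      also have "\<dots> = ennreal (a * c) * ennreal (g p / (1 + norm p))"
      proof -
        have "a * g p * (c / (1 + norm p)) = a * c * (g p / (1 + norm p))" by simp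
        then show ?thesis using assms(2) nn[of p] c(1) by (simp only: ennreal_mult[symmetric]
            mult_nonneg_nonneg divide_nonneg_nonneg add_nonneg_nonneg norm_ge_zero zero_le_one)
      qed
      finally show "(\<integral>\<^sup>+z. F z p \<partial>mu_Sigma) \<le> ennreal (a * c) * ennreal (g p / (1 + norm p))" .
    qed
    also have "\<dots> = ennreal (a * c) * (\<integral>\<^sup>+p. g p / (1 + norm p) \<partial>lborel)"
      by (rule nn_integral_cmult) measurable
    finally have le: "ennreal V * (\<integral>\<^sup>+z. g z \<partial>mu_Sigma) \<le> ennreal (a * c) * (\<integral>\<^sup>+p. g p / (1 + norm p) \<partial>lborel)" .
    have "(\<integral>\<^sup>+z. g z \<partial>mu_Sigma) = ennreal (1 / V) * (ennreal V * (\<integral>\<^sup>+z. g z \<partial>mu_Sigma))"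
    proof -
      have "ennreal (1 / V) * ennreal V = 1" using V by (subst ennreal_mult[symmetric]) auto
      then show ?thesis by (simp only: mult.assoc[symmetric] mult_1_left)
    qed
    also have "\<dots> \<le> ennreal (1 / V) * (ennreal (a * c) * (\<integral>\<^sup>+p. g p / (1 + norm p) \<partial>lborel))"
      by (rule mult_left_mono[OF le]) simp
    also have "\<dots> = ennreal (a * c / V) * (\<integral>\<^sup>+p. g p / (1 + norm p) \<partial>lborel)"
    proof -
      have "ennreal (1 / V) * ennreal (a * c) = ennreal (a * c / V)"
        using V assms(2) c(1) by (subst ennreal_mult[symmetric]) auto
      then show ?thesis by (simp only: mult.assoc[symmetric])
    qed
    finally show "(\<integral>\<^sup>+z. g z \<partial>mu_Sigma) \<le> ennreal (a * c / V) * (\<integral>\<^sup>+p. g p / (1 + norm p) \<partial>lborel)" .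
  qed
qed

section \<open>Weights\<close>

text \<open>Lifting s to (1, s) lets the bracket inherit the triangle inequality of the
  norm.\<close>

lemma jbr_eq_norm: "jbr s = norm (1 :: real, s)"
  by (simp add: jbr_def norm_Pair)

lemma jbr_ge_1: "jbr s \<ge> 1"
  by (simp add: jbr_def)

lemma jbr_pos [simp]: "jbr s > 0"
  using jbr_ge_1[of s] by linarith

lemma norm_le_jbr: "norm s \<le> jbr s"
  unfolding jbr_eq_norm by (metis norm_snd_le snd_conv)

lemma jbr_le_one_plus_norm: "jbr s \<le> 1 + norm s"
  unfolding jbr_def by (rule real_le_lsqrt) (auto simp: power2_eq_square algebra_simps)

lemma jbr_triangle: "jbr x \<le> jbr y + norm (x - y)"
  using norm_triangle_sub[of "(1 :: real, x)" "(1, y)"] by (simp add: jbr_eq_norm norm_Pair)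

text \<open>Since the bracket is at least 1, an additive change by c is absorbed in a factor 1 +
  c.\<close>

lemma jbr_le_mult:
  assumes "norm (x - y) \<le> c"
  shows "jbr x \<le> (1 + c) * jbr y"
proof -
  have "c \<ge> 0" using assms norm_ge_zero order_trans by blast
  then have "c * 1 \<le> c * jbr y" by (intro mult_left_mono jbr_ge_1)
  then show ?thesis using jbr_triangle[of x y] assms by (simp add: algebra_simps)
qed

lemma continuous_jbr [continuous_intros]: "continuous_on A jbr"
  unfolding jbr_def by (intro continuous_intros)

text \<open>The decay profile of functions in C_r, which replaces v in all size estimates.\<close>

definition weight :: "real \<Rightarrow> 'a::real_normed_vector \<Rightarrow> real" where
  "weight r x = jbr x powr (- r)"

lemma weight_pos [simp]: "weight r x > 0"
  using jbr_pos[of x] by (simp add: weight_def less_imp_neq[THEN not_sym])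

lemma weight_nonneg [simp]: "weight r x \<ge> 0"
  by (simp add: less_imp_le)

lemma continuous_on_weight: "continuous_on A (weight r)"
  unfolding weight_def by (intro continuous_intros) (metis jbr_pos less_irrefl)

lemma weight_measurable [measurable]:
  "weight r \<in> borel_measurable (borel :: 'a::real_normed_vector measure)"
  by (intro borel_measurable_continuous_onI continuous_on_weight)

lemma measurable_fst_snd_borel [measurable]:
  "(fst :: 'a::euclidean_space \<times> 'b::euclidean_space \<Rightarrow> 'a) \<in> borel \<rightarrow>\<^sub>M borel"
  "(snd :: 'a::euclidean_space \<times> 'b::euclidean_space \<Rightarrow> 'b) \<in> borel \<rightarrow>\<^sub>M borel"
  by (intro borel_measurable_continuous_onI continuous_intros)+

lemma weight_le_mult:
  assumes "jbr x \<le> c * jbr y" "c > 0" "r \<ge> 0"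
  shows "weight r y \<le> c powr r * weight r x"
proof -
  have "jbr x powr r \<le> (c * jbr y) powr r"
    using assms jbr_pos[of x] by (intro powr_mono2) (auto simp: less_imp_le)
  also have "\<dots> = c powr r * jbr y powr r"
    using assms jbr_pos[of y] by (intro powr_mult)
  moreover have "jbr x powr r > 0" "jbr y powr r > 0"
    using jbr_pos[of x] jbr_pos[of y] by (simp_all only: powr_gt_zero)
  ultimately show ?thesis
    by (simp add: weight_def powr_minus_divide field_simps)
qed

text \<open>On the shell where the bracket lies between 2^k and 2^(k+1), the weight has order 2^(-k
  r) and the enclosing ball has volume of order 2^(k d). The ratio 2^(d - r) is below 1 because r >
  d.\<close>

lemma nn_integral_weight_finite:
  fixes r :: real
  assumes "r > real DIM('a::euclidean_space)"
  shows "(\<integral>\<^sup>+x. weight r (x :: 'a) \<partial>lborel) < \<infinity>"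
proof -
  define d where "d = DIM('a)"
  define V where "V = unit_ball_vol (real d)"
  have V: "V \<ge> 0" by (simp add: V_def)
  define B :: "nat \<Rightarrow> 'a set" where "B k = ball 0 (2 ^ Suc k)" for k
  have [measurable]: "B k \<in> sets borel" for k by (simp add: B_def)
  have shell: "ennreal (weight r x) \<le> (\<Sum>k. ennreal ((2 ^ k) powr (- r)) * indicator (B k) x)" for x
  proof -
    have "\<exists>k. jbr x < 2 ^ k" by (rule real_arch_pow) simp
    define j where "j = (LEAST k. jbr x < 2 ^ k)"
    have j: "jbr x < 2 ^ j" unfolding j_def using LeastI_ex[OF \<open>\<exists>k. jbr x < 2 ^ k\<close>] .
    \<comment> \<open>The bracket is at least 1 = 2^0, so the first admissible index is
      positive.\<close>
    then have "j \<noteq> 0" using jbr_ge_1[of x] by (intro notI) simp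
    then obtain k where k: "j = Suc k" using not0_implies_Suc by blast
    have "k < (LEAST k. jbr x < 2 ^ k)" using k by (simp add: j_def)
    then have "\<not> jbr x < 2 ^ k" by (rule not_less_Least)
    then have "weight r x \<le> (2 ^ k) powr (- r)"
      unfolding weight_def using assms by (intro powr_mono2') auto
    moreover have "x \<in> B k" using norm_le_jbr[of x] j k by (simp add: B_def)
    ultimately have "ennreal (weight r x) \<le> ennreal ((2 ^ k) powr (- r)) * indicator (B k) x"
      by (simp add: ennreal_leI)
    also have "\<dots> \<le> (\<Sum>k. ennreal ((2 ^ k) powr (- r)) * indicator (B k) x)"
      by (rule le_suminf_ennreal)
    finally show ?thesis .
  qed
  have shell_term: "ennreal ((2 ^ k) powr (- r)) * emeasure lborel (B k) = ennreal (V * 2 ^ d * (2 powr (real d - r)) ^ k)" for k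
  proof -
    have "(2 ^ k) powr (- r) * (2 ^ Suc k) ^ d = 2 ^ d * ((2 :: real) powr (real d - r)) ^ k"
    proof -
      have "(2 :: real) ^ k = 2 powr real k" by (simp add: powr_realpow)
      then have "((2 :: real) ^ k) powr (- r) = 2 powr (- (real k * r))" by (simp add: powr_powr)
      moreover have "(2 ^ Suc k) ^ d = (2 :: real) ^ d * 2 powr (real k * real d)"
        by (simp add: power_mult_distrib powr_realpow flip: power_mult of_nat_mult)
      moreover have "((2 :: real) powr (real d - r)) ^ k = 2 powr (- (real k * r)) * 2 powr (real k * real d)"
        by (simp add: powr_power algebra_simps flip: powr_add)
      ultimately show ?thesis by simp
    qed
    then have "(2 ^ k) powr (- r) * (V * (2 ^ Suc k) ^ d) = V * 2 ^ d * (2 powr (real d - r)) ^ k"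
      by (metis mult.left_commute mult.assoc)
    moreover have "emeasure lborel (B k) = ennreal (V * (2 ^ Suc k) ^ d)"
      unfolding B_def V_def d_def by (subst emeasure_ball) auto
    ultimately show ?thesis using V by (simp only: ennreal_mult'[symmetric] powr_ge_zero)
  qed
  have "(\<integral>\<^sup>+x. weight r (x :: 'a) \<partial>lborel) \<le> (\<integral>\<^sup>+x. (\<Sum>k. ennreal ((2 ^ k) powr (- r)) * indicator (B k) x) \<partial>lborel)"
    by (rule nn_integral_mono) (rule shell)
  also have "\<dots> = (\<Sum>k. ennreal ((2 ^ k) powr (- r)) * emeasure lborel (B k))"
    by (subst nn_integral_suminf) (simp_all add: nn_integral_cmult_indicator)
  also have "\<dots> = (\<Sum>k. ennreal (V * 2 ^ d * (2 powr (real d - r)) ^ k))"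
    by (simp only: shell_term)
  also have "\<dots> < \<infinity>"
  proof -
    have "2 powr (real d - r) < (1 :: real)" using assms by (simp add: d_def powr_less_one)
    then have "summable (\<lambda>k. V * 2 ^ d * (2 powr (real d - r)) ^ k)"
      by (intro summable_mult summable_geometric) simp
    then show ?thesis using V by (subst suminf_ennreal2) auto
  qed
  finally show ?thesis .
qed

section \<open>Lebesgue integrals of products of weights\<close>

lemma nn_integral_lborel_translate:
  fixes f :: "'a::euclidean_space \<Rightarrow> ennreal"
  assumes [measurable]: "f \<in> borel_measurable borel"
  shows "(\<integral>\<^sup>+x. f (x + s) \<partial>lborel) = (\<integral>\<^sup>+x. f x \<partial>lborel)"
proof -
  have "(\<integral>\<^sup>+x. f x \<partial>lborel) = (\<integral>\<^sup>+x. f x \<partial>distr lborel borel ((+) s))"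
    by (simp only: lborel_distr_plus)
  also have "\<dots> = (\<integral>\<^sup>+x. f (x + s) \<partial>lborel)"
    by (subst nn_integral_distr) (auto simp: add.commute)
  finally show ?thesis ..
qed

text \<open>The source of the extra decay 1 / \<langle>s\<rangle>. Multiply by \<langle>s\<rangle>
  \<le> a + b, with a and b the brackets of x + s and x: the term with b cancels the denominator,
  and the term with a is bounded by one of the two weights according to which bracket is
  larger.\<close>

lemma weight_div_jbr_le:
  fixes x s :: "'a::real_normed_vector"
  assumes "r \<ge> 1"
  shows "weight r (x + s) / jbr x \<le> (2 * weight r (x + s) + weight r x) / jbr s"
proof -
  define a b where "a = jbr (x + s)" and "b = jbr x"
  have ab: "a > 0" "b > 0" by (simp_all add: a_def b_def)
  have "jbr s \<le> a + b"
    using jbr_triangle[of s "x + s"] norm_le_jbr[of x] by (simp add: a_def b_def)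
  have "a * a powr (- r) / b \<le> a powr (- r) + b powr (- r)"
  proof (cases "a \<le> b")
    case True
    then have "a * a powr (- r) \<le> b * a powr (- r)" by (intro mult_right_mono) auto
    then have "a * a powr (- r) / b \<le> a powr (- r)" using ab by (simp add: field_simps)
    then show ?thesis by (simp add: add_increasing2)
  next
    \<comment> \<open>Here b < a, and \<open>a powr (1 - r)\<close> is nonincreasing in a because r
      \<ge> 1.\<close>
    case False
    have "a * a powr (- r) = a powr (1 - r)"
      using ab by (simp add: powr_diff powr_minus_divide)
    also have "\<dots> \<le> b powr (1 - r)"
      using False ab assms by (intro powr_mono2') auto
    also have "\<dots> = b * b powr (- r)"
      using ab by (simp add: powr_diff powr_minus_divide)
    finally have "a * a powr (- r) / b \<le> b powr (- r)" using ab by (simp add: field_simps)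
    then show ?thesis by (simp add: add_increasing)
  qed
  moreover have "jbr s * (a powr (- r) / b) \<le> (a + b) * (a powr (- r) / b)"
    using \<open>jbr s \<le> a + b\<close> ab by (intro mult_right_mono) auto
  ultimately have "jbr s * (a powr (- r) / b) \<le> 2 * a powr (- r) + b powr (- r)"
    using ab by (simp add: distrib_right add_divide_distrib)
  then show ?thesis
    by (simp add: weight_def a_def b_def field_simps)
qed

text \<open>The second elementary symmetric polynomial in the weights at the corners s + x, s + y
  and s + x + y of the rectangle. It is what remains of the cubic products once a weight at s has
  been split off.\<close>

definition pair_weight :: "real \<Rightarrow> 'a::real_normed_vector \<Rightarrow> 'a \<times> 'a \<Rightarrow> real" where
  "pair_weight r s z =
     weight r (fst z + s) * weight r (snd z + s)
     + weight r (fst z + s) * weight r (fst z + snd z + s)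
     + weight r (snd z + s) * weight r (fst z + snd z + s)"

lemma pair_weight_nonneg [simp]: "pair_weight r s z \<ge> 0"
  by (simp add: pair_weight_def)

lemma pair_weight_measurable [measurable]:
  "pair_weight r s \<in> borel_measurable (borel :: ('a::euclidean_space \<times> 'a) measure)"
  unfolding pair_weight_def by measurable

text \<open>Two centres s and t serve two uses: s = t gives the slow variation required for
  averaging, and z = p gives a common majorant for nearby s. A displacement of at most 2 costs a
  factor \<open>3 powr r\<close> per weight.\<close>

lemma pair_weight_slowly_varying:
  assumes "norm (fst z + s - (fst p + t)) \<le> 2" "norm (snd z + s - (snd p + t)) \<le> 2"
    "norm (fst z + snd z + s - (fst p + snd p + t)) \<le> 2" "r \<ge> 0"
  shows "pair_weight r s z \<le> (3 powr r)\<^sup>2 * pair_weight r t p"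
proof -
  have *: "weight r x \<le> 3 powr r * weight r y" if "norm (x - y) \<le> 2" for x y :: 'a
    using jbr_le_mult[of y x 2] that assms(4) by (intro weight_le_mult) (auto simp: norm_minus_commute)
  have "pair_weight r s z \<le>
     (3 powr r * weight r (fst p + t)) * (3 powr r * weight r (snd p + t))
     + (3 powr r * weight r (fst p + t)) * (3 powr r * weight r (fst p + snd p + t))
     + (3 powr r * weight r (snd p + t)) * (3 powr r * weight r (fst p + snd p + t))"
    unfolding pair_weight_def using assms(1-3) by (intro add_mono mult_mono *) auto
  also have "\<dots> = (3 powr r)\<^sup>2 * pair_weight r t p"
    by (simp add: pair_weight_def power2_eq_square algebra_simps)
  finally show ?thesis .
qed

text \<open>In each product 1 / (1 + |p|) is weakened to 1 / \<langle>x\<rangle> or 1 /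
  \<langle>y\<rangle> and attached to the factor in that variable alone. The other factor is
  integrated first, by translation invariance; what is left has order 1 /
  \<langle>s\<rangle>.\<close>

lemma nn_integral_pair_weight_lborel_le:
  assumes r: "r > real DIM('a::euclidean_space)"
  obtains c :: real where "c \<ge> 0"
    "\<And>s :: 'a. (\<integral>\<^sup>+p. pair_weight r s p / (1 + norm p) \<partial>lborel) \<le> ennreal (c / jbr s)"
proof -
  have "r \<ge> 1" using r DIM_positive[where 'a='a] by linarith
  obtain i where i: "i \<ge> 0" "(\<integral>\<^sup>+x. weight r (x :: 'a) \<partial>lborel) = ennreal i"
    using nn_integral_weight_finite[OF r] by (metis ennreal_cases infinity_ennreal_def less_irrefl)
  have shift: "(\<integral>\<^sup>+x. weight r (x + t) \<partial>lborel) = ennreal i" for t :: 'a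
    unfolding i(2)[symmetric] by (rule nn_integral_lborel_translate) measurable
  have quot: "(\<integral>\<^sup>+x. weight r (x + s) / jbr x \<partial>lborel) \<le> ennreal (3 * i / jbr s)" for s :: 'a
  proof -
    have "(\<integral>\<^sup>+x. weight r (x + s) / jbr x \<partial>lborel)
        \<le> (\<integral>\<^sup>+x. ennreal (1 / jbr s) * (ennreal 2 * ennreal (weight r (x + s)) + ennreal (weight r x)) \<partial>lborel)"
    proof (rule nn_integral_mono)
      fix x
      have "ennreal (weight r (x + s) / jbr x) \<le> ennreal ((2 * weight r (x + s) + weight r x) / jbr s)"
        using weight_div_jbr_le[OF \<open>r \<ge> 1\<close>] by (rule ennreal_leI)
      also have "\<dots> = ennreal (1 / jbr s) * (ennreal 2 * ennreal (weight r (x + s)) + ennreal (weight r x))"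
        by (simp flip: ennreal_mult ennreal_plus add: less_imp_le del: ennreal_numeral)
      finally show "ennreal (weight r (x + s) / jbr x) \<le> \<dots>" .
    qed
    also have "\<dots> = ennreal (1 / jbr s) * (ennreal 2 * ennreal i + ennreal i)"
      by (simp add: nn_integral_cmult nn_integral_add shift i(2) del: ennreal_numeral)
    also have "\<dots> = ennreal (3 * i / jbr s)"
      using i(1) by (simp flip: ennreal_mult ennreal_plus add: less_imp_le del: ennreal_numeral)
    finally show ?thesis .
  qed
  have jbr_meas [measurable]: "jbr \<in> borel_measurable (borel :: 'a measure)"
    by (intro borel_measurable_continuous_onI continuous_intros)
  have prod_fst: "(\<integral>\<^sup>+p. f p \<partial>lborel) = (\<integral>\<^sup>+x. \<integral>\<^sup>+y. f (x, y) \<partial>lborel \<partial>lborel)"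
    and prod_snd: "(\<integral>\<^sup>+p. f p \<partial>lborel) = (\<integral>\<^sup>+y. \<integral>\<^sup>+x. f (x, y) \<partial>lborel \<partial>lborel)"
    if [measurable]: "f \<in> borel_measurable borel" for f :: "'a \<times> 'a \<Rightarrow> ennreal"
  proof -
    have m: "f \<in> borel_measurable (lborel \<Otimes>\<^sub>M lborel)"
      unfolding lborel_prod by measurable
    show "(\<integral>\<^sup>+p. f p \<partial>lborel) = (\<integral>\<^sup>+x. \<integral>\<^sup>+y. f (x, y) \<partial>lborel \<partial>lborel)"
      using lborel.nn_integral_fst[OF m] by (simp add: lborel_prod)
    show "(\<integral>\<^sup>+p. f p \<partial>lborel) = (\<integral>\<^sup>+y. \<integral>\<^sup>+x. f (x, y) \<partial>lborel \<partial>lborel)"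
      using lborel_pair.nn_integral_snd[OF m] by (simp add: lborel_prod)
  qed
  \<comment> \<open>The inner integral is over y with x fixed, so the shift \<open>t x\<close> may
    depend on x. This covers both products that contain the weight at x + s.\<close>
  have bound1: "(\<integral>\<^sup>+p. ennreal (weight r (fst p + s) / jbr (fst p)) * ennreal (weight r (h p)) \<partial>lborel)
      \<le> ennreal (3 * i / jbr s) * ennreal i"
    if h: "\<And>x y. h (x, y) = y + t x" and [measurable]: "h \<in> borel \<rightarrow>\<^sub>M borel"
    for h :: "'a \<times> 'a \<Rightarrow> 'a" and t s
  proof -
    have "(\<integral>\<^sup>+p. ennreal (weight r (fst p + s) / jbr (fst p)) * ennreal (weight r (h p)) \<partial>lborel)
        = (\<integral>\<^sup>+x. ennreal (weight r (x + s) / jbr x) * ennreal i \<partial>lborel)"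
      by (subst prod_fst) (simp_all add: h nn_integral_cmult shift)
    also have "\<dots> \<le> ennreal (3 * i / jbr s) * ennreal i"
      by (subst nn_integral_multc) (auto intro: mult_right_mono quot)
    finally show ?thesis .
  qed
  \<comment> \<open>The order is reversed: x is integrated first, with shift y + s.\<close>
  have bound2: "(\<integral>\<^sup>+p. ennreal (weight r (snd p + s) / jbr (snd p)) * ennreal (weight r (fst p + snd p + s)) \<partial>lborel)
      \<le> ennreal (3 * i / jbr s) * ennreal i" for s :: 'a
  proof -
    have "(\<integral>\<^sup>+p. ennreal (weight r (snd p + s) / jbr (snd p)) * ennreal (weight r (fst p + snd p + s)) \<partial>lborel)
        = (\<integral>\<^sup>+y. ennreal (weight r (y + s) / jbr y) * ennreal i \<partial>lborel)"
      by (subst prod_snd) (simp_all add: nn_integral_cmult shift add.assoc)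
    also have "\<dots> \<le> ennreal (3 * i / jbr s) * ennreal i"
      by (subst nn_integral_multc) (auto intro: mult_right_mono quot)
    finally show ?thesis .
  qed
  show thesis
  \<comment> \<open>Three products, each contributing 3 i * i / \<langle>s\<rangle>.\<close>
  proof (rule that[of "9 * i\<^sup>2"])
    fix s :: 'a
    let ?w = "\<lambda>x::'a. weight r (x + s)"
    have "(\<integral>\<^sup>+p. pair_weight r s p / (1 + norm p) \<partial>lborel)
       \<le> (\<integral>\<^sup>+p. ennreal (?w (fst p) / jbr (fst p)) * ennreal (?w (snd p))
          + ennreal (?w (fst p) / jbr (fst p)) * ennreal (?w (fst p + snd p))
          + ennreal (?w (snd p) / jbr (snd p)) * ennreal (?w (fst p + snd p)) \<partial>lborel)"
    proof (rule nn_integral_mono)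
      fix p :: "'a \<times> 'a"
      have x: "jbr (fst p) \<le> 1 + norm p" and y: "jbr (snd p) \<le> 1 + norm p"
        using jbr_le_one_plus_norm[of "fst p"] jbr_le_one_plus_norm[of "snd p"]
          norm_fst_le[of "fst p" "snd p"] norm_snd_le[of "snd p" "fst p"] by simp_all
      have q: "a * b / (1 + norm p) \<le> a / j * b" if "0 < j" "j \<le> 1 + norm p" "a \<ge> 0" "b \<ge> 0" for a b j
        using that frac_le[of "a * b" "a * b" j "1 + norm p"] by simp
      have "pair_weight r s p / (1 + norm p) \<le> ?w (fst p) / jbr (fst p) * ?w (snd p)
          + ?w (fst p) / jbr (fst p) * ?w (fst p + snd p)
          + ?w (snd p) / jbr (snd p) * ?w (fst p + snd p)"
        unfolding pair_weight_def add_divide_distrib by (intro add_mono q x y) auto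
      then show "ennreal (pair_weight r s p / (1 + norm p))
          \<le> ennreal (?w (fst p) / jbr (fst p)) * ennreal (?w (snd p))
          + ennreal (?w (fst p) / jbr (fst p)) * ennreal (?w (fst p + snd p))
          + ennreal (?w (snd p) / jbr (snd p)) * ennreal (?w (fst p + snd p))"
        by (simp flip: ennreal_mult ennreal_plus add: less_imp_le ennreal_leI)
    qed
    also have "\<dots> = (\<integral>\<^sup>+p. ennreal (?w (fst p) / jbr (fst p)) * ennreal (?w (snd p)) \<partial>lborel)
          + (\<integral>\<^sup>+p. ennreal (?w (fst p) / jbr (fst p)) * ennreal (?w (fst p + snd p)) \<partial>lborel)
          + (\<integral>\<^sup>+p. ennreal (?w (snd p) / jbr (snd p)) * ennreal (?w (fst p + snd p)) \<partial>lborel)"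
      by (simp add: nn_integral_add)
    also have "\<dots> \<le> ennreal (3 * i / jbr s) * ennreal i + ennreal (3 * i / jbr s) * ennreal i
        + ennreal (3 * i / jbr s) * ennreal i"
      using bound1[of "\<lambda>p. snd p + s" "\<lambda>_. s" s] bound1[of "\<lambda>p. fst p + snd p + s" "\<lambda>x. x + s" s]
      by (intro add_mono bound2) (auto simp: algebra_simps)
    also have "\<dots> = ennreal (9 * i\<^sup>2 / jbr s)"
      using i(1) by (simp flip: ennreal_mult ennreal_plus add: less_imp_le power2_eq_square)
    finally show "(\<integral>\<^sup>+p. pair_weight r s p / (1 + norm p) \<partial>lborel) \<le> ennreal (9 * i\<^sup>2 / jbr s)" .
  qed simp
qed

section \<open>The collision integral\<close>

lemma in_Cr_le_weight:
  assumes "in_Cr r v"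
  shows "cmod (v x) \<le> wnorm r v * weight r x"
proof -
  have "cmod (v x) * jbr x powr r \<le> wnorm r v"
    unfolding wnorm_def using assms by (intro cSUP_upper) (auto simp: in_Cr_def)
  moreover have "jbr x powr r > 0" using jbr_pos[of x] by (simp only: powr_gt_zero)
  ultimately show ?thesis by (simp add: weight_def powr_minus_divide field_simps)
qed

lemma wnorm_nonneg:
  fixes v :: "'a::real_normed_vector \<Rightarrow> complex"
  assumes "in_Cr r v"
  shows "wnorm r v \<ge> 0"
proof -
  have "0 \<le> wnorm r v * weight r (0 :: 'a)"
    by (rule order_trans[OF norm_ge_zero in_Cr_le_weight[OF assms]])
  then show ?thesis using weight_pos[of r "0 :: 'a"] by (simp add: zero_le_mult_iff)
qed

text \<open>The points s, s + x, s + x + y, s + y form a rectangle, so the squared norms of s + x and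
  s + y add up to at least that of s: one of the two points is at least comparable to s.\<close>
lemma weight_mult_le_Sigma:
  fixes x y s :: "'a::real_inner"
  assumes "x \<bullet> y = 0" "r \<ge> 0"
  shows "weight r (x + s) * weight r (y + s) \<le> 2 powr r * weight r s * (weight r (x + s) + weight r (y + s))"
proof -
  have "(norm (x + s))\<^sup>2 + (norm (y + s))\<^sup>2 = (norm s)\<^sup>2 + (norm (x + y + s))\<^sup>2"
    using assms(1) by (simp add: power2_norm_eq_inner inner_simps inner_commute)
  then have "(norm s)\<^sup>2 \<le> (norm (x + s))\<^sup>2 + (norm (y + s))\<^sup>2" by simp
  then have sq: "(jbr s)\<^sup>2 \<le> (jbr (x + s))\<^sup>2 + (jbr (y + s))\<^sup>2" by (simp add: jbr_def)
  have "jbr s \<le> 2 * jbr (x + s) \<or> jbr s \<le> 2 * jbr (y + s)"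
  proof (rule ccontr)
    assume "\<not> ?thesis"
    then have "(2 * jbr (x + s))\<^sup>2 < (jbr s)\<^sup>2" "(2 * jbr (y + s))\<^sup>2 < (jbr s)\<^sup>2"
      by (intro power_strict_mono; simp add: less_imp_le)+
    then have "4 * (jbr (x + s))\<^sup>2 < (jbr s)\<^sup>2" "4 * (jbr (y + s))\<^sup>2 < (jbr s)\<^sup>2"
      by (simp_all add: power_mult_distrib)
    then show False using sq zero_le_power2[of "jbr s"] by linarith
  qed
  then have "weight r (x + s) \<le> 2 powr r * weight r s \<or> weight r (y + s) \<le> 2 powr r * weight r s"
    using weight_le_mult[of s 2 "x + s" r] weight_le_mult[of s 2 "y + s" r] assms(2) by auto
  then show ?thesis
  proof
    assume "weight r (x + s) \<le> 2 powr r * weight r s"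
    then have "weight r (x + s) * weight r (y + s) \<le> 2 powr r * weight r s * weight r (y + s)"
      by (rule mult_right_mono) simp
    also have "\<dots> \<le> 2 powr r * weight r s * (weight r (x + s) + weight r (y + s))"
      by (intro mult_left_mono) auto
    finally show ?thesis .
  next
    assume "weight r (y + s) \<le> 2 powr r * weight r s"
    then have "weight r (x + s) * weight r (y + s) \<le> weight r (x + s) * (2 powr r * weight r s)"
      by (rule mult_left_mono) simp
    also have "\<dots> = 2 powr r * weight r s * weight r (x + s)" by simp
    also have "\<dots> \<le> 2 powr r * weight r s * (weight r (x + s) + weight r (y + s))"
      by (intro mult_left_mono) auto
    finally show ?thesis .
  qed
qed

text \<open>Three of the four products contain v s and hence a weight at s. For the remaining one,
  v1 v2 v3, the rectangle inequality supplies it, at the price of the factor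
  \<open>2 powr r\<close>.\<close>

lemma norm_K_integrand_le:
  assumes v: "in_Cr r v" and "r \<ge> 0" and z: "z \<in> Sigma_star"
  shows "cmod (K_integrand v s z) \<le> (wnorm r v) ^ 3 * ((2 powr r + 1) * weight r s * pair_weight r s z)"
proof -
  obtain x y where xy: "z = (x, y)" "x \<bullet> y = 0" using z by (cases z) (auto simp: Sigma_star_def)
  define N where "N = wnorm r v"
  have N: "N \<ge> 0" using wnorm_nonneg[OF v] by (simp add: N_def)
  define w1 w2 w3 w4 where "w1 = weight r (x + s)" and "w2 = weight r (y + s)"
    and "w3 = weight r (x + y + s)" and "w4 = weight r s"
  have w: "w1 \<ge> 0" "w2 \<ge> 0" "w3 \<ge> 0" "w4 \<ge> 0" by (simp_all add: w1_def w2_def w3_def w4_def)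
  have vle: "cmod (v (x + s)) \<le> N * w1" "cmod (v (y + s)) \<le> N * w2"
    "cmod (v (x + y + s)) \<le> N * w3" "cmod (v s) \<le> N * w4"
    unfolding N_def w1_def w2_def w3_def w4_def by (rule in_Cr_le_weight[OF v])+
  have triple: "cmod (a * b * c) \<le> N ^ 3 * (\<alpha> * \<beta> * \<gamma>)"
    if "cmod a \<le> N * \<alpha>" "cmod b \<le> N * \<beta>" "cmod c \<le> N * \<gamma>" "\<alpha> \<ge> 0" "\<beta> \<ge> 0" for a b c \<alpha> \<beta> \<gamma>
  proof -
    have "cmod (a * b * c) \<le> N * \<alpha> * (N * \<beta>) * (N * \<gamma>)"
      unfolding norm_mult using that N by (intro mult_mono) auto
    then show ?thesis by (simp add: power3_eq_cube mult_ac)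
  qed
  have "cmod (K_integrand v s z) \<le> cmod (v (x + s) * v (y + s) * v (x + y + s))
      + cmod (v (x + s) * v (y + s) * v s) + cmod (v (x + s) * v (x + y + s) * v s)
      + cmod (v (y + s) * v (x + y + s) * v s)"
    unfolding K_integrand_def xy(1) Let_def fst_conv snd_conv
    by (intro order_trans[OF norm_triangle_ineq4] add_mono order_trans[OF norm_triangle_ineq] order_refl)
  also have "\<dots> \<le> N ^ 3 * (w1 * w2 * w3) + N ^ 3 * (w1 * w2 * w4) + N ^ 3 * (w1 * w3 * w4) + N ^ 3 * (w2 * w3 * w4)"
    using w vle by (intro add_mono triple)
  also have "\<dots> = N ^ 3 * (w1 * w2 * w3 + w4 * (w1 * w2 + w1 * w3 + w2 * w3))"
    by (simp add: algebra_simps)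
  also have "\<dots> \<le> N ^ 3 * ((2 powr r + 1) * w4 * (w1 * w2 + w1 * w3 + w2 * w3))"
  proof (rule mult_left_mono)
    \<comment> \<open>The product w1 w2 is traded for w4 (w1 + w2); multiplied by w3, this gives two
      of the three terms of the pair weight.\<close>
    have "w1 * w2 * w3 \<le> 2 powr r * w4 * (w1 + w2) * w3"
      using weight_mult_le_Sigma[OF xy(2) \<open>r \<ge> 0\<close>, of s] w
      unfolding w1_def w2_def w4_def by (intro mult_right_mono)
    also have "\<dots> \<le> 2 powr r * w4 * (w1 * w2 + w1 * w3 + w2 * w3)"
      using w by (simp add: mult.assoc distrib_right mult_left_mono)
    finally show "w1 * w2 * w3 + w4 * (w1 * w2 + w1 * w3 + w2 * w3) \<le> (2 powr r + 1) * w4 * (w1 * w2 + w1 * w3 + w2 * w3)"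
      by (simp add: algebra_simps)
  qed (use N in simp)
  finally show ?thesis
    by (simp add: N_def w1_def w2_def w3_def w4_def pair_weight_def xy)
qed

text \<open>Averaging passes from the cone to Lebesgue measure on the whole space, where the decay 1
  / \<langle>s\<rangle> has been computed. The slow-variation constant is a square since each term
  is a product of two weights.\<close>

lemma pair_weight_integral_mu_Sigma:
  assumes "DIM('a::euclidean_space) \<ge> 2" and r: "r > real DIM('a)"
  obtains c :: real where "c \<ge> 0"
    "\<And>s :: 'a. integrable mu_Sigma (pair_weight r s)"
    "\<And>s :: 'a. (LINT z|mu_Sigma. pair_weight r s z) \<le> c / jbr s"
proof -
  have "r \<ge> 0" using r by (rule order_trans[OF of_nat_0_le_iff less_imp_le])
  obtain c1 :: real where c1: "c1 \<ge> 0"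
    "\<And>g :: 'a \<times> 'a \<Rightarrow> real. g \<in> borel_measurable borel \<Longrightarrow> (\<And>z. g z \<ge> 0) \<Longrightarrow>
       (\<And>z p. dist z p < 1 \<Longrightarrow> g z \<le> (3 powr r)\<^sup>2 * g p) \<Longrightarrow>
       (\<integral>\<^sup>+z. g z \<partial>mu_Sigma) \<le> ennreal c1 * (\<integral>\<^sup>+p. g p / (1 + norm p) \<partial>lborel)"
    using nn_integral_mu_Sigma_le[OF assms(1), of "(3 powr r)\<^sup>2"] zero_le_power2 by blast
  obtain c2 :: real where c2: "c2 \<ge> 0"
    "\<And>s :: 'a. (\<integral>\<^sup>+p. pair_weight r s p / (1 + norm p) \<partial>lborel) \<le> ennreal (c2 / jbr s)"
    using nn_integral_pair_weight_lborel_le[OF r] by blast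
  have bound: "(\<integral>\<^sup>+z. pair_weight r s z \<partial>mu_Sigma) \<le> ennreal (c1 * c2 / jbr s)" for s :: 'a
  proof -
    have "(\<integral>\<^sup>+z. pair_weight r s z \<partial>mu_Sigma)
        \<le> ennreal c1 * (\<integral>\<^sup>+p. pair_weight r s p / (1 + norm p) \<partial>lborel)"
    proof (rule c1(2))
      fix z p :: "'a \<times> 'a" assume "dist z p < 1"
      then have zp: "norm (z - p) < 1" by (simp add: dist_norm)
      have x: "norm (fst z - fst p) \<le> 1" and y: "norm (snd z - snd p) \<le> 1"
        using norm_fst_le[of "fst (z - p)" "snd (z - p)"] norm_snd_le[of "snd (z - p)" "fst (z - p)"] zp
        unfolding prod.collapse by simp_all
      have "fst z + snd z + s - (fst p + snd p + s) = (fst z - fst p) + (snd z - snd p)" by simp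
      \<comment> \<open>A move of z by less than 1 shifts x and y by at most 1 each, hence x + y by
        at most 2.\<close>
      moreover have "norm ((fst z - fst p) + (snd z - snd p)) \<le> 2"
        using norm_triangle_ineq[of "fst z - fst p" "snd z - snd p"] x y by linarith
      ultimately have "norm (fst z + snd z + s - (fst p + snd p + s)) \<le> 2" by (simp only:)
      then show "pair_weight r s z \<le> (3 powr r)\<^sup>2 * pair_weight r s p"
        using x y \<open>r \<ge> 0\<close> by (intro pair_weight_slowly_varying) auto
    qed auto
    also have "\<dots> \<le> ennreal c1 * ennreal (c2 / jbr s)" by (intro mult_left_mono c2) auto
    also have "\<dots> = ennreal (c1 * c2 / jbr s)"
      using c1(1) c2(1) by (subst ennreal_mult[symmetric]) (auto simp: less_imp_le)
    finally show ?thesis .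
  qed
  show thesis
  proof (rule that[of "c1 * c2"])
    fix s :: 'a
    have meas: "pair_weight r s \<in> borel_measurable mu_Sigma"
      using pair_weight_measurable by (simp add: measurable_cong_sets[OF sets_mu_Sigma refl])
    show int: "integrable mu_Sigma (pair_weight r s)"
      using meas order_le_less_trans[OF bound[of s]] by (intro integrableI_nonneg) auto
    have "ennreal (LINT z|mu_Sigma. pair_weight r s z) \<le> ennreal (c1 * c2 / jbr s)"
      using nn_integral_eq_integral[OF int] bound[of s] by simp
    then show "(LINT z|mu_Sigma. pair_weight r s z) \<le> c1 * c2 / jbr s"
      using c1(1) c2(1) by (simp add: ennreal_le_iff less_imp_le)
  qed (use c1 c2 in simp)
qed

section \<open>Continuity in s and the final estimate\<close>

lemma continuous_on_K_integrand:
  assumes "continuous_on UNIV v"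
  shows "continuous_on UNIV (K_integrand v s)" "continuous_on UNIV (\<lambda>s. K_integrand v s z)"
proof -
  have v: "continuous_on A (\<lambda>x. v (f x))" if "continuous_on A f" for f :: "'b::topological_space \<Rightarrow> 'a" and A
    using continuous_on_compose2[OF assms that] by simp
  show "continuous_on UNIV (K_integrand v s)"
    unfolding K_integrand_def Let_def by (intro continuous_intros v)
  have v': "continuous_on A (\<lambda>x. v (f x))" if "continuous_on A f" for f :: "'a \<Rightarrow> 'a" and A
    using continuous_on_compose2[OF assms that] by simp
  show "continuous_on UNIV (\<lambda>s. K_integrand v s z)"
    unfolding K_integrand_def Let_def by (intro continuous_intros v')
qed

text \<open>Dominated convergence along sequences, locally on unit balls: for s in the ball around
  s0, the pair weight centred at s is controlled by the one centred at s0, which is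
  integrable.\<close>

lemma continuous_on_wave_K:
  fixes v :: "'a::euclidean_space \<Rightarrow> complex"
  assumes "DIM('a) \<ge> 2" and r: "r > real DIM('a)" and v: "in_Cr r v"
  shows "continuous_on UNIV (wave_K v)"
proof -
  have "r \<ge> 0" using r by (rule order_trans[OF of_nat_0_le_iff less_imp_le])
  have cont: "continuous_on UNIV v" using v by (simp add: in_Cr_def)
  define I where "I s = (LINT z|mu_Sigma. K_integrand v s z)" for s
  have meas: "K_integrand v s \<in> borel_measurable mu_Sigma" for s
    using borel_measurable_continuous_onI[OF continuous_on_K_integrand(1)[OF cont]]
    by (simp add: measurable_cong_sets[OF sets_mu_Sigma refl])
  have "continuous_on (ball s0 1) I" for s0
    unfolding continuous_on_sequentially
  proof (intro allI ballI impI, elim conjE)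
    fix u s assume s: "s \<in> ball s0 1" and u: "\<forall>n. u n \<in> ball s0 1" and lim: "u \<longlonglongrightarrow> s"
    \<comment> \<open>The pointwise bound of the integrand with \<open>weight r (u n)\<close>
      replaced by 1 and the centre moved from \<open>u n\<close> to \<open>s0\<close>.\<close>
    define g where "g z = (wnorm r v) ^ 3 * ((2 powr r + 1) * ((3 powr r)\<^sup>2 * pair_weight r s0 z))" for z
    have "(\<lambda>n. LINT z|mu_Sigma. K_integrand v (u n) z) \<longlonglongrightarrow> (LINT z|mu_Sigma. K_integrand v s z)"
    proof (rule integral_dominated_convergence[where w = g])
      obtain c :: real where "\<And>s :: 'a. integrable mu_Sigma (pair_weight r s)"
        using pair_weight_integral_mu_Sigma[OF assms(1) r] by blast
      then show "integrable mu_Sigma g"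
        unfolding g_def by (intro integrable_mult_right) auto
      have "(\<lambda>n. K_integrand v (u n) z) \<longlonglongrightarrow> K_integrand v s z" for z
        using continuous_on_tendsto_compose[OF continuous_on_K_integrand(2)[OF cont] lim] by simp
      then show "AE z in mu_Sigma. (\<lambda>n. K_integrand v (u n) z) \<longlonglongrightarrow> K_integrand v s z"
        by simp
      fix n
      show "AE z in mu_Sigma. norm (K_integrand v (u n) z) \<le> g z"
        using AE_mu_Sigma
      proof eventually_elim
        case (elim z)
        have un: "norm (u n - s0) \<le> 1" using u by (simp add: dist_norm norm_minus_commute less_imp_le)
        have diffs: "fst z + u n - (fst z + s0) = u n - s0" "snd z + u n - (snd z + s0) = u n - s0"
          "fst z + snd z + u n - (fst z + snd z + s0) = u n - s0" by simp_all
        have pw: "pair_weight r (u n) z \<le> (3 powr r)\<^sup>2 * pair_weight r s0 z"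
          using un \<open>r \<ge> 0\<close> by (intro pair_weight_slowly_varying) (simp_all only: diffs)
        have "weight r (u n) \<le> 1"
          unfolding weight_def using jbr_ge_1[of "u n"] \<open>r \<ge> 0\<close> powr_mono[of "- r" 0 "jbr (u n)"]
          by (simp add: less_imp_neq[OF jbr_pos, symmetric])
        then have "weight r (u n) * pair_weight r (u n) z \<le> 1 * ((3 powr r)\<^sup>2 * pair_weight r s0 z)"
          by (intro mult_mono pw) auto
        then have "(2 powr r + 1) * (weight r (u n) * pair_weight r (u n) z) \<le> (2 powr r + 1) * ((3 powr r)\<^sup>2 * pair_weight r s0 z)"
          by (intro mult_left_mono) auto
        then have "(wnorm r v) ^ 3 * ((2 powr r + 1) * weight r (u n) * pair_weight r (u n) z) \<le> g z"
          unfolding g_def mult.assoc by (rule mult_left_mono) (simp add: wnorm_nonneg[OF v])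
        with norm_K_integrand_le[OF v \<open>r \<ge> 0\<close> elim] show ?case by (rule order_trans)
      qed
    qed (rule meas)+
    then show "(I \<circ> u) \<longlonglongrightarrow> I s" by (simp add: I_def comp_def)
  qed
  then have "isCont I s" for s
    using continuous_on_eq_continuous_at[OF open_ball, of s 1 I] by simp
  then have "continuous_on UNIV I" by (simp add: continuous_on_eq_continuous_at)
  then show ?thesis unfolding wave_K_def I_def by (intro continuous_intros)
qed

text \<open>Integrability is asserted along with the bound because the integral of a non-integrable
  function is 0 by convention. The constant is chosen before v and so depends only on r and the
  dimension.\<close>

theorem theorem4p1:
  fixes r :: real
  assumes "DIM('a::euclidean_space) \<ge> 2"
    and "r > real DIM('a)"
  shows "\<exists>C::real. \<forall>v :: 'a \<Rightarrow> complex. in_Cr r v \<longrightarrow>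
           (\<forall>s. integrable mu_Sigma (K_integrand v s)) \<and>
           in_Cr (r + 1) (wave_K v) \<and>
           wnorm (r + 1) (wave_K v) \<le> C * (wnorm r v) ^ 3"
proof -
  have "r \<ge> 0" using assms(2) by (rule order_trans[OF of_nat_0_le_iff less_imp_le])
  obtain c :: real where c: "c \<ge> 0" "\<And>s :: 'a. integrable mu_Sigma (pair_weight r s)"
    "\<And>s :: 'a. (LINT z|mu_Sigma. pair_weight r s z) \<le> c / jbr s"
    using pair_weight_integral_mu_Sigma[OF assms] by blast
  \<comment> \<open>The factor 2 pi comes from the definition of \<open>wave_K\<close>,
    \<open>2 powr r + 1\<close> from the pointwise bound on the cone, and \<open>c\<close> from the
    integral of the pair weight.\<close>
  define C where "C = 2 * pi * (2 powr r + 1) * c"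
  show ?thesis
  proof (intro exI[of _ C] allI impI)
    fix v :: "'a \<Rightarrow> complex" assume v: "in_Cr r v"
    define N where "N = wnorm r v"
    have N: "N \<ge> 0" using wnorm_nonneg[OF v] by (simp add: N_def)
    have cont: "continuous_on UNIV v" using v by (simp add: in_Cr_def)
    define g where "g s z = N ^ 3 * ((2 powr r + 1) * weight r s * pair_weight r s z)" for s :: 'a and z
    have g: "integrable mu_Sigma (g s)" for s
      unfolding g_def by (intro integrable_mult_right c)
    have le: "AE z in mu_Sigma. cmod (K_integrand v s z) \<le> g s z" for s
      using AE_mu_Sigma
      by eventually_elim (auto simp: g_def N_def intro!: norm_K_integrand_le v \<open>r \<ge> 0\<close>)
    have int: "integrable mu_Sigma (K_integrand v s)" for s
    proof (rule Bochner_Integration.integrable_bound[OF g[of s]])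
      show "K_integrand v s \<in> borel_measurable mu_Sigma"
        using borel_measurable_continuous_onI[OF continuous_on_K_integrand(1)[OF cont]]
        by (simp add: measurable_cong_sets[OF sets_mu_Sigma refl])
      show "AE z in mu_Sigma. cmod (K_integrand v s z) \<le> norm (g s z)"
        using le[of s] by eventually_elim simp
    qed
    have bound: "cmod (wave_K v s) * jbr s powr (r + 1) \<le> C * N ^ 3" for s
    proof -
      have "cmod (LINT z|mu_Sigma. K_integrand v s z) \<le> (LINT z|mu_Sigma. g s z)"
        by (rule order_trans[OF integral_norm_bound integral_mono_AE[OF integrable_norm[OF int] g le]])
      also have "\<dots> = N ^ 3 * ((2 powr r + 1) * weight r s * (LINT z|mu_Sigma. pair_weight r s z))"
        by (simp add: g_def)
      also have "\<dots> \<le> N ^ 3 * ((2 powr r + 1) * weight r s * (c / jbr s))"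
        using N by (intro mult_left_mono c) auto
      finally have "cmod (wave_K v s) \<le> 2 * pi * (N ^ 3 * ((2 powr r + 1) * weight r s * (c / jbr s)))"
        unfolding wave_K_def norm_mult by (intro mult_mono) auto
      also have "\<dots> = C * N ^ 3 * (weight r s / jbr s)" by (simp add: C_def)
      finally have "cmod (wave_K v s) * jbr s powr (r + 1) \<le> C * N ^ 3 * (weight r s / jbr s) * jbr s powr (r + 1)"
        by (intro mult_right_mono) auto
      also have "\<dots> = C * N ^ 3 * (weight r s / jbr s * jbr s powr (r + 1))" by simp
      \<comment> \<open>The weight at s gives r powers of decay and the integral gives one more,
        which together cancel the factor of order r + 1.\<close>
      also have "weight r s / jbr s * jbr s powr (r + 1) = 1"
        using jbr_pos[of s] by (simp add: weight_def powr_minus_divide powr_add abs_of_pos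
            less_imp_neq[OF jbr_pos, symmetric])
      finally show ?thesis by simp
    qed
    have "in_Cr (r + 1) (wave_K v)"
      unfolding in_Cr_def
      using continuous_on_wave_K[OF assms v] bdd_aboveI2[of UNIV _ "C * N ^ 3", OF bound] by simp
    moreover have "wnorm (r + 1) (wave_K v) \<le> C * N ^ 3"
      unfolding wnorm_def using bound by (intro cSUP_least) auto
    ultimately show "(\<forall>s. integrable mu_Sigma (K_integrand v s)) \<and> in_Cr (r + 1) (wave_K v) \<and>
        wnorm (r + 1) (wave_K v) \<le> C * (wnorm r v) ^ 3"
      using int by (simp add: N_def)
  qed
qed

end
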